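(* In the setting of the context, let $\mathcal M:=\prod_{a\in[\mathrm{Irr}\,O_{\Lambda^{(0)}}]}U(1)$ be the $G$-module on which $g\in G$ acts by $(x_a)_a\mapsto(x_{a^{(g^{-1})}})_a$. Put, for $g,h\in G$ and $a\in[\mathrm{Irr}\,O_{\Lambda^{(0)}}]$, $$\eta(g,h):=(\eta_a(g,h))_a\in\mathcal M,\qquad \eta_a(g,h):=\omega^{(a^{((gh)^{-1})})}(g,h).$$ Then $\eta\in Z^2(G,\mathcal M)$, i.e. $$\eta_{a^{(g^{-1})}}(h,k)\,\eta_a(g,hk)=\eta_a(gh,k)\,\eta_a(g,h)\qquad\text{for all }g,h,k\in G\text{ and all }a,$$ and the cohomology class of $\eta$ in $H^2(G,\mathcal M)$ is independent of the choice of the unitaries $W_a^{(g)}$.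
   Context: **Setting.** Fix an integer $d\ge 2$. For $z\in\mathbb Z^2$ let $\mathcal A_{\{z\}}$ be a copy of $M_d(\mathbb C)$; for $\Gamma\subset\mathbb Z^2$ let $\mathcal A_\Gamma$ be the C*-inductive limit of $\bigotimes_{z\in\Lambda}\mathcal A_{\{z\}}$ over finite $\Lambda\subset\Gamma$; $\mathcal A=\mathcal A_{\mathbb Z^2}$. For $\Gamma\subset\mathbb R^2$ put $\mathcal A_\Gamma:=\mathcal A_{\Gamma\cap\mathbb Z^2}$ and $\Gamma^c=\mathbb R^2\setminus\Gamma$. $\omega$ is a pure state on $\mathcal A$ with GNS triple $(\mathcal H,\pi,\Omega)$. $G$ is a finite group and $U$ a unitary representation of $G$ on $\mathbb C^d$ such that $g\mapsto\mathrm{Ad}\,U_g$ is faithful. $\beta_g$ is the automorphism of $\mathcal A$ acting as $\mathrm{Ad}(\bigotimes_I U_g)$ on $\mathcal A_I$ for finite $I\subset\mathbb Z^2$. It is assumed that $\omega\circ\beta_g=\omega$ for all $g$; $R$ is a unitary representation of $G$ on $\mathcal H$ with $\mathrm{Ad}R_g\circ\pi=\pi\circ\beta_g$. Here $\mathrm{Ad}(V)(x)=VxV^*$. **Cones and anyons.** A cone is $\Lambda_{x,\theta,\varphi}=x+\{t(\cos\beta,\sin\beta): t>0,\ \beta\in(\theta-\varphi,\theta+\varphi)\}$, $x\in\mathbb R^2$, $\theta\in\mathbb R$, $\varphi\in(0,\pi)$, with $\arg\Lambda_{x,\theta,\varphi}=\{e^{it}:t\in[\theta-\varphi,\theta+\varphi]\}$.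 $\mathcal C_{(\theta,\varphi)}$ is the set of cones whose $\arg$ is disjoint from $\{e^{it}:t\in[\theta-\varphi,\theta+\varphi]\}$. A representation $\rho$ of $\mathcal A$ on $\mathcal H$ satisfies the superselection criterion if for every cone $\Lambda$ there is a unitary $V$ on $\mathcal H$ with $\mathrm{Ad}(V)\circ\rho=\pi$ on $\mathcal A_{\Lambda^c}$. Fix $\varphi_0\in(0,\pi/2)$ and a cone $\Lambda^{(0)}\in\mathcal C_{(3\pi/2,\pi/2)}\cap\mathcal C_{(0,\varphi_0)}$. $O_{\Lambda^{(0)}}$ is the set of $\rho$ satisfying the criterion with $\rho=\pi$ on $\mathcal A_{(\Lambda^{(0)})^c}$; $[\mathrm{Irr}\,O_{\Lambda^{(0)}}]$ is the set of unitary equivalence classes of irreducible elements of $O_{\Lambda^{(0)}}$; for each class $a$ fix a representative $\rho_a\in a$. $\Theta(g)(\rho):=\mathrm{Ad}R_g\circ\rho\circ\beta_{g^{-1}}$ maps $O_{\Lambda^{(0)}}$ to itself; $a^{(g)}:=[\Theta(g)(\rho_a)]$, which satisfies $(a^{(h)})^{(g)}=a^{(gh)}$. For each $a,g$ choose a unitary $W_a^{(g)}$ on $\mathcal H$ with $\Theta(g)(\rho_a)=\mathrm{Ad}(W_a^{(g)})\rho_{a^{(g)}}$, and set $$\omega^{(a)}(g,h):=(W^{(g)}_{a^{(h)}})^*R_g(W_a^{(h)})^*R_g^*W_a^{(gh)}\in U(1).$$ *)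

theory Defs
  imports
    "HOL-Analysis.Analysis"
    "HOL-Algebra.Coset"
    "HOL-Algebra.Bij"
    "HOL-Algebra.Product_Groups"
begin

section \<open>C*-algebras, Hilbert spaces, operators\<close>

class complex_normed_vector = real_normed_vector +
  fixes scaleC :: "complex \<Rightarrow> 'a \<Rightarrow> 'a" (infixr \<open>*\<^sub>C\<close> 75)
  assumes scaleC_add_right: "c *\<^sub>C (x + y) = c *\<^sub>C x + c *\<^sub>C y"
    and scaleC_add_left: "(c + c') *\<^sub>C x = c *\<^sub>C x + c' *\<^sub>C x"
    and scaleC_scaleC: "c *\<^sub>C c' *\<^sub>C x = (c * c') *\<^sub>C x"
    and scaleC_of_real: "complex_of_real r *\<^sub>C x = r *\<^sub>R x"
    and norm_scaleC: "norm (c *\<^sub>C x) = cmod c * norm x"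

class cstar_algebra = complex_normed_vector + real_normed_algebra_1 + complete_space +
  fixes star :: "'a \<Rightarrow> 'a"
  assumes mult_scaleC_left: "(c *\<^sub>C x) * y = c *\<^sub>C (x * y)"
    and mult_scaleC_right: "x * (c *\<^sub>C y) = c *\<^sub>C (x * y)"
    and star_star: "star (star x) = x"
    and star_add: "star (x + y) = star x + star y"
    and star_scaleC: "star (c *\<^sub>C x) = cnj c *\<^sub>C star x"
    and star_mult: "star (x * y) = star y * star x"
    and cstar_identity: "norm (star x * x) = (norm x)\<^sup>2"

text \<open>The inner product is antilinear in the first and linear in the second argument.\<close>

class chilbert_space = complex_normed_vector + complete_space +
  fixes cinner :: "'a \<Rightarrow> 'a \<Rightarrow> complex"
  assumes cinner_commute: "cinner x y = cnj (cinner y x)"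
    and cinner_add_right: "cinner x (y + z) = cinner x y + cinner x z"
    and cinner_scaleC_right: "cinner x (c *\<^sub>C y) = c * cinner x y"
    and cinner_self: "cinner x x = complex_of_real ((norm x)\<^sup>2)"

definition clinear_map :: "('a::complex_normed_vector \<Rightarrow> 'b::complex_normed_vector) \<Rightarrow> bool" where
  "clinear_map T \<longleftrightarrow> (\<forall>x y. T (x + y) = T x + T y) \<and> (\<forall>c x. T (c *\<^sub>C x) = c *\<^sub>C T x)"

definition bounded_operator :: "('h::chilbert_space \<Rightarrow> 'h) \<Rightarrow> bool" where
  "bounded_operator T \<longleftrightarrow> clinear_map T \<and> (\<exists>K. \<forall>v. norm (T v) \<le> K * norm v)"

definition hadj :: "('h::chilbert_space \<Rightarrow> 'h) \<Rightarrow> 'h \<Rightarrow> 'h" where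
  "hadj T = (THE S. \<forall>v w. cinner (T v) w = cinner v (S w))"

definition unitary_operator :: "('h::chilbert_space \<Rightarrow> 'h) \<Rightarrow> bool" where
  "unitary_operator V \<longleftrightarrow> bounded_operator V \<and> surj V \<and> (\<forall>v w. cinner (V v) (V w) = cinner v w)"

definition Ad :: "('h::chilbert_space \<Rightarrow> 'h) \<Rightarrow> ('h \<Rightarrow> 'h) \<Rightarrow> 'h \<Rightarrow> 'h" where
  "Ad V T = V \<circ> T \<circ> hadj V"

definition star_automorphism :: "('a::cstar_algebra \<Rightarrow> 'a) \<Rightarrow> bool" where
  "star_automorphism f \<longleftrightarrow> bij f \<and>
     (\<forall>x y. f (x + y) = f x + f y) \<and> (\<forall>c x. f (c *\<^sub>C x) = c *\<^sub>C f x) \<and>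
     (\<forall>x y. f (x * y) = f x * f y) \<and> (\<forall>x. f (star x) = star (f x))"

definition representation :: "('a::cstar_algebra \<Rightarrow> 'h::chilbert_space \<Rightarrow> 'h) \<Rightarrow> bool" where
  "representation \<rho> \<longleftrightarrow>
     (\<forall>x. bounded_operator (\<rho> x)) \<and>
     (\<forall>x y v. \<rho> (x + y) v = \<rho> x v + \<rho> y v) \<and> (\<forall>c x v. \<rho> (c *\<^sub>C x) v = c *\<^sub>C \<rho> x v) \<and>
     (\<forall>x y. \<rho> (x * y) = \<rho> x \<circ> \<rho> y) \<and>
     (\<forall>x v w. cinner (\<rho> x v) w = cinner v (\<rho> (star x) w))"

definition csubspace :: "'h::chilbert_space set \<Rightarrow> bool" where
  "csubspace S \<longleftrightarrow> 0 \<in> S \<and> (\<forall>v\<in>S. \<forall>w\<in>S. v + w \<in> S) \<and> (\<forall>c. \<forall>v\<in>S. c *\<^sub>C v \<in> S)"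

definition irreducible_rep :: "('a::cstar_algebra \<Rightarrow> 'h::chilbert_space \<Rightarrow> 'h) \<Rightarrow> bool" where
  "irreducible_rep \<rho> \<longleftrightarrow>
     (\<forall>S. csubspace S \<longrightarrow> closed S \<longrightarrow> (\<forall>x. \<rho> x ` S \<subseteq> S) \<longrightarrow> S = {0} \<or> S = UNIV)"

definition unitarily_equivalent ::
  "('a::cstar_algebra \<Rightarrow> 'h::chilbert_space \<Rightarrow> 'h) \<Rightarrow> ('a \<Rightarrow> 'h \<Rightarrow> 'h) \<Rightarrow> bool" where
  "unitarily_equivalent \<rho> \<sigma> \<longleftrightarrow> (\<exists>V. unitary_operator V \<and> (\<forall>x. Ad V (\<rho> x) = \<sigma> x))"

definition state :: "('a::cstar_algebra \<Rightarrow> complex) \<Rightarrow> bool" where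
  "state \<omega> \<longleftrightarrow>
     (\<forall>x y. \<omega> (x + y) = \<omega> x + \<omega> y) \<and> (\<forall>c x. \<omega> (c *\<^sub>C x) = c * \<omega> x) \<and>
     (\<forall>x. \<omega> (star x * x) \<in> \<real>\<^sub>\<ge>\<^sub>0) \<and> \<omega> 1 = 1"

definition pure_state :: "('a::cstar_algebra \<Rightarrow> complex) \<Rightarrow> bool" where
  "pure_state \<omega> \<longleftrightarrow> state \<omega> \<and>
     (\<forall>\<omega>\<^sub>1 \<omega>\<^sub>2 t. state \<omega>\<^sub>1 \<longrightarrow> state \<omega>\<^sub>2 \<longrightarrow> 0 < t \<longrightarrow> t < 1 \<longrightarrow>
        (\<forall>x. \<omega> x = complex_of_real t * \<omega>\<^sub>1 x + complex_of_real (1 - t) * \<omega>\<^sub>2 x) \<longrightarrow>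
        \<omega>\<^sub>1 = \<omega> \<and> \<omega>\<^sub>2 = \<omega>)"

definition GNS_triple ::
  "('a::cstar_algebra \<Rightarrow> complex) \<Rightarrow> ('a \<Rightarrow> 'h::chilbert_space \<Rightarrow> 'h) \<Rightarrow> 'h \<Rightarrow> bool" where
  "GNS_triple \<omega> \<pi> \<Omega> \<longleftrightarrow> representation \<pi> \<and> closure (range (\<lambda>x. \<pi> x \<Omega>)) = UNIV \<and>
     (\<forall>x. \<omega> x = cinner \<Omega> (\<pi> x \<Omega>))"


section \<open>The quasi-local algebra\<close>

type_synonym site = "int \<times> int"
type_synonym 'd config = "site \<Rightarrow> 'd"
type_synonym 'd local_matrix = "'d config \<Rightarrow> 'd config \<Rightarrow> complex"

text \<open>
  For finite \<open>\<Lambda>\<close>, the tensor product over \<open>z \<in> \<Lambda>\<close> of copies of the matrix algebra over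
  the index type \<open>'d\<close> is the algebra of matrices whose rows and columns are indexed
  by the configurations \<open>\<Lambda> \<rightarrow> 'd\<close> (the product basis). Configurations on \<open>\<Lambda>\<close> are
  functions that are \<open>undefined\<close> outside \<open>\<Lambda>\<close>, and matrices vanish outside the configurations
  on \<open>\<Lambda>\<close>.
\<close>

definition configs :: "site set \<Rightarrow> 'd::finite config set" where
  "configs \<Lambda> = (\<Lambda> \<rightarrow>\<^sub>E UNIV)"

definition local_matrices :: "site set \<Rightarrow> 'd::finite local_matrix set" where
  "local_matrices \<Lambda> = {X. \<forall>s t. X s t \<noteq> 0 \<longrightarrow> s \<in> configs \<Lambda> \<and> t \<in> configs \<Lambda>}"

definition local_mult ::
  "site set \<Rightarrow> 'd::finite local_matrix \<Rightarrow> 'd local_matrix \<Rightarrow> 'd local_matrix" where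
  "local_mult \<Lambda> X Y = (\<lambda>s t. \<Sum>r\<in>configs \<Lambda>. X s r * Y r t)"

definition local_one :: "site set \<Rightarrow> 'd::finite local_matrix" where
  "local_one \<Lambda> = (\<lambda>s t. if s \<in> configs \<Lambda> \<and> s = t then 1 else 0)"

definition local_star :: "'d::finite local_matrix \<Rightarrow> 'd local_matrix" where
  "local_star X = (\<lambda>s t. cnj (X t s))"

definition tensor_matrix :: "site set \<Rightarrow> (site \<Rightarrow> complex^'d^'d) \<Rightarrow> 'd::finite local_matrix" where
  "tensor_matrix \<Lambda> A =
     (\<lambda>s t. if s \<in> configs \<Lambda> \<and> t \<in> configs \<Lambda> then \<Prod>z\<in>\<Lambda>. A z $ s z $ t z else 0)"

text \<open>The inclusion \<open>X \<mapsto> X \<otimes> 1\<close> of the matrices on \<open>\<Lambda>\<close> into those on \<open>\<Lambda>' \<supseteq> \<Lambda>\<close>.\<close>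

definition amplify :: "site set \<Rightarrow> site set \<Rightarrow> 'd::finite local_matrix \<Rightarrow> 'd local_matrix" where
  "amplify \<Lambda> \<Lambda>' X =
     (\<lambda>s t. if s \<in> configs \<Lambda>' \<and> t \<in> configs \<Lambda>' \<and> (\<forall>z\<in>\<Lambda>' - \<Lambda>. s z = t z)
            then X (restrict s \<Lambda>) (restrict t \<Lambda>) else 0)"

text \<open>
  \<open>quasi_local \<iota>\<close> says that the C*-algebra \<open>'a\<close>, with the maps \<open>\<iota> \<Lambda>\<close>, is a C*-inductive limit
  of the local matrix algebras; this determines it up to isomorphism. (Injective
  *-homomorphisms between C*-algebras are automatically isometric.)
\<close>

definition quasi_local :: "(site set \<Rightarrow> 'd::finite local_matrix \<Rightarrow> 'a::cstar_algebra) \<Rightarrow> bool" where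
  "quasi_local \<iota> \<longleftrightarrow>
     (\<forall>\<Lambda>. finite \<Lambda> \<longrightarrow>
        inj_on (\<iota> \<Lambda>) (local_matrices \<Lambda>) \<and>
        \<iota> \<Lambda> (local_one \<Lambda>) = 1 \<and>
        (\<forall>X\<in>local_matrices \<Lambda>. \<forall>Y\<in>local_matrices \<Lambda>.
           \<iota> \<Lambda> (\<lambda>s t. X s t + Y s t) = \<iota> \<Lambda> X + \<iota> \<Lambda> Y \<and>
           \<iota> \<Lambda> (local_mult \<Lambda> X Y) = \<iota> \<Lambda> X * \<iota> \<Lambda> Y) \<and>
        (\<forall>X\<in>local_matrices \<Lambda>.
           (\<forall>c. \<iota> \<Lambda> (\<lambda>s t. c * X s t) = c *\<^sub>C \<iota> \<Lambda> X) \<and>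
           \<iota> \<Lambda> (local_star X) = star (\<iota> \<Lambda> X))) \<and>
     (\<forall>\<Lambda> \<Lambda>'. finite \<Lambda>' \<longrightarrow> \<Lambda> \<subseteq> \<Lambda>' \<longrightarrow>
        (\<forall>X\<in>local_matrices \<Lambda>. \<iota> \<Lambda>' (amplify \<Lambda> \<Lambda>' X) = \<iota> \<Lambda> X)) \<and>
     closure (\<Union>\<Lambda>\<in>{\<Lambda>. finite \<Lambda>}. \<iota> \<Lambda> ` local_matrices \<Lambda>) = UNIV"

definition lattice_points :: "(real \<times> real) set \<Rightarrow> site set" where
  "lattice_points \<Gamma> = {z. (real_of_int (fst z), real_of_int (snd z)) \<in> \<Gamma>}"

definition region_algebra ::
  "(site set \<Rightarrow> 'd::finite local_matrix \<Rightarrow> 'a::cstar_algebra) \<Rightarrow> (real \<times> real) set \<Rightarrow> 'a set" where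
  "region_algebra \<iota> \<Gamma> =
     closure (\<Union>\<Lambda>\<in>{\<Lambda>. finite \<Lambda> \<and> \<Lambda> \<subseteq> lattice_points \<Gamma>}. \<iota> \<Lambda> ` local_matrices \<Lambda>)"


section \<open>Symmetry\<close>

definition madj :: "complex^'n^'m \<Rightarrow> complex^'m^'n" where
  "madj A = map_matrix cnj (transpose A)"

definition unitary_matrix :: "complex^'n^'n \<Rightarrow> bool" where
  "unitary_matrix A \<longleftrightarrow> A ** madj A = mat 1 \<and> madj A ** A = mat 1"

definition unitary_matrix_rep :: "('g, 'm) monoid_scheme \<Rightarrow> ('g \<Rightarrow> complex^'n^'n) \<Rightarrow> bool" where
  "unitary_matrix_rep G U \<longleftrightarrow> (\<forall>g\<in>carrier G. unitary_matrix (U g)) \<and>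
     (\<forall>g\<in>carrier G. \<forall>h\<in>carrier G. U (g \<otimes>\<^bsub>G\<^esub> h) = U g ** U h)"

definition mAd :: "complex^'n^'n \<Rightarrow> complex^'n^'n \<Rightarrow> complex^'n^'n" where
  "mAd V X = V ** X ** madj V"

definition unitary_operator_rep ::
  "('g, 'm) monoid_scheme \<Rightarrow> ('g \<Rightarrow> 'h::chilbert_space \<Rightarrow> 'h) \<Rightarrow> bool" where
  "unitary_operator_rep G R \<longleftrightarrow> (\<forall>g\<in>carrier G. unitary_operator (R g)) \<and>
     (\<forall>g\<in>carrier G. \<forall>h\<in>carrier G. R (g \<otimes>\<^bsub>G\<^esub> h) = R g \<circ> R h)"

definition onsite_action ::
  "('g, 'm) monoid_scheme \<Rightarrow> ('g \<Rightarrow> complex^'d^'d) \<Rightarrow>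
   (site set \<Rightarrow> 'd::finite local_matrix \<Rightarrow> 'a::cstar_algebra) \<Rightarrow> ('g \<Rightarrow> 'a \<Rightarrow> 'a) \<Rightarrow> bool" where
  "onsite_action G U \<iota> \<beta> \<longleftrightarrow>
     (\<forall>g\<in>carrier G. star_automorphism (\<beta> g) \<and>
        (\<forall>I. finite I \<longrightarrow> (\<forall>X\<in>local_matrices I.
           \<beta> g (\<iota> I X) =
           \<iota> I (local_mult I (local_mult I (tensor_matrix I (\<lambda>_. U g)) X)
                  (local_star (tensor_matrix I (\<lambda>_. U g)))))))"


section \<open>Cones and superselection sectors\<close>

definition cone :: "real \<times> real \<Rightarrow> real \<Rightarrow> real \<Rightarrow> (real \<times> real) set" where
  "cone x \<theta> \<phi> = {x + t *\<^sub>R (cos b, sin b) | t b. 0 < t \<and> b \<in> {\<theta> - \<phi><..<\<theta> + \<phi>}}"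

definition arc :: "real \<Rightarrow> real \<Rightarrow> complex set" where
  "arc \<theta> \<phi> = cis ` {\<theta> - \<phi>..\<theta> + \<phi>}"

definition cones :: "(real \<times> real) set set" where
  "cones = {cone x \<theta> \<phi> | x \<theta> \<phi>. 0 < \<phi> \<and> \<phi> < pi}"

definition cones_avoiding :: "real \<Rightarrow> real \<Rightarrow> (real \<times> real) set set" where
  "cones_avoiding \<theta> \<phi> =
     {cone x \<theta>' \<phi>' | x \<theta>' \<phi>'. 0 < \<phi>' \<and> \<phi>' < pi \<and> arc \<theta>' \<phi>' \<inter> arc \<theta> \<phi> = {}}"

definition superselection ::
  "(site set \<Rightarrow> 'd::finite local_matrix \<Rightarrow> 'a::cstar_algebra) \<Rightarrow>
   ('a \<Rightarrow> 'h::chilbert_space \<Rightarrow> 'h) \<Rightarrow> ('a \<Rightarrow> 'h \<Rightarrow> 'h) \<Rightarrow> bool" where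
  "superselection \<iota> \<pi> \<rho> \<longleftrightarrow>
     (\<forall>\<Lambda>\<in>cones. \<exists>V. unitary_operator V \<and> (\<forall>x\<in>region_algebra \<iota> (- \<Lambda>). Ad V (\<rho> x) = \<pi> x))"

definition O_set ::
  "(site set \<Rightarrow> 'd::finite local_matrix \<Rightarrow> 'a::cstar_algebra) \<Rightarrow>
   ('a \<Rightarrow> 'h::chilbert_space \<Rightarrow> 'h) \<Rightarrow> (real \<times> real) set \<Rightarrow> ('a \<Rightarrow> 'h \<Rightarrow> 'h) set" where
  "O_set \<iota> \<pi> \<Lambda>\<^sub>0 = {\<rho>. representation \<rho> \<and> superselection \<iota> \<pi> \<rho> \<and>
     (\<forall>x\<in>region_algebra \<iota> (- \<Lambda>\<^sub>0). \<rho> x = \<pi> x)}"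

definition Irr_equiv ::
  "(site set \<Rightarrow> 'd::finite local_matrix \<Rightarrow> 'a::cstar_algebra) \<Rightarrow>
   ('a \<Rightarrow> 'h::chilbert_space \<Rightarrow> 'h) \<Rightarrow> (real \<times> real) set \<Rightarrow>
   (('a \<Rightarrow> 'h \<Rightarrow> 'h) \<times> ('a \<Rightarrow> 'h \<Rightarrow> 'h)) set" where
  "Irr_equiv \<iota> \<pi> \<Lambda>\<^sub>0 = {(\<rho>, \<sigma>). \<rho> \<in> O_set \<iota> \<pi> \<Lambda>\<^sub>0 \<and> irreducible_rep \<rho> \<and>
     \<sigma> \<in> O_set \<iota> \<pi> \<Lambda>\<^sub>0 \<and> irreducible_rep \<sigma> \<and> unitarily_equivalent \<rho> \<sigma>}"

definition sectors ::
  "(site set \<Rightarrow> 'd::finite local_matrix \<Rightarrow> 'a::cstar_algebra) \<Rightarrow>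
   ('a \<Rightarrow> 'h::chilbert_space \<Rightarrow> 'h) \<Rightarrow> (real \<times> real) set \<Rightarrow> ('a \<Rightarrow> 'h \<Rightarrow> 'h) set set" where
  "sectors \<iota> \<pi> \<Lambda>\<^sub>0 = {\<rho> \<in> O_set \<iota> \<pi> \<Lambda>\<^sub>0. irreducible_rep \<rho>} // Irr_equiv \<iota> \<pi> \<Lambda>\<^sub>0"

definition Theta ::
  "('g, 'm) monoid_scheme \<Rightarrow> ('g \<Rightarrow> 'h::chilbert_space \<Rightarrow> 'h) \<Rightarrow> ('g \<Rightarrow> 'a::cstar_algebra \<Rightarrow> 'a) \<Rightarrow>
   'g \<Rightarrow> ('a \<Rightarrow> 'h \<Rightarrow> 'h) \<Rightarrow> 'a \<Rightarrow> 'h \<Rightarrow> 'h" where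
  "Theta G R \<beta> g \<rho> = (\<lambda>x. Ad (R g) (\<rho> (\<beta> (inv\<^bsub>G\<^esub> g) x)))"

text \<open>
  The remaining definitions take the set \<open>S\<close> of sectors, the chosen representatives
  \<open>rep a \<in> a\<close> and the map \<open>mv g a\<close>, which is \<open>a\<^sup>(\<^sup>g\<^sup>)\<close>, as parameters. The families
  \<open>W a g\<close> stand for the unitaries with superscript \<open>g\<close> and subscript \<open>a\<close>.
\<close>

definition intertwiners ::
  "('g, 'm) monoid_scheme \<Rightarrow> ('g \<Rightarrow> 'h::chilbert_space \<Rightarrow> 'h) \<Rightarrow> ('g \<Rightarrow> 'a::cstar_algebra \<Rightarrow> 'a) \<Rightarrow>
   's set \<Rightarrow> ('s \<Rightarrow> 'a \<Rightarrow> 'h \<Rightarrow> 'h) \<Rightarrow> ('g \<Rightarrow> 's \<Rightarrow> 's) \<Rightarrow> ('s \<Rightarrow> 'g \<Rightarrow> 'h \<Rightarrow> 'h) \<Rightarrow> bool" where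
  "intertwiners G R \<beta> S rep mv W \<longleftrightarrow> (\<forall>a\<in>S. \<forall>g\<in>carrier G. unitary_operator (W a g) \<and>
     (\<forall>x. Theta G R \<beta> g (rep a) x = Ad (W a g) (rep (mv g a) x)))"

definition omega_operator ::
  "('g, 'm) monoid_scheme \<Rightarrow> ('g \<Rightarrow> 'h::chilbert_space \<Rightarrow> 'h) \<Rightarrow> ('g \<Rightarrow> 's \<Rightarrow> 's) \<Rightarrow>
   ('s \<Rightarrow> 'g \<Rightarrow> 'h \<Rightarrow> 'h) \<Rightarrow> 's \<Rightarrow> 'g \<Rightarrow> 'g \<Rightarrow> 'h \<Rightarrow> 'h" where
  "omega_operator G R mv W a g h =
     hadj (W (mv h a) g) \<circ> R g \<circ> hadj (W a h) \<circ> hadj (R g) \<circ> W a (g \<otimes>\<^bsub>G\<^esub> h)"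

text \<open>The scalar \<open>c\<close> with \<open>omega_operator G R mv W a g h = c \<cdot> 1\<close>.\<close>

definition omega_scalar ::
  "('g, 'm) monoid_scheme \<Rightarrow> ('g \<Rightarrow> 'h::chilbert_space \<Rightarrow> 'h) \<Rightarrow> ('g \<Rightarrow> 's \<Rightarrow> 's) \<Rightarrow>
   ('s \<Rightarrow> 'g \<Rightarrow> 'h \<Rightarrow> 'h) \<Rightarrow> 's \<Rightarrow> 'g \<Rightarrow> 'g \<Rightarrow> complex" where
  "omega_scalar G R mv W a g h = (THE c. omega_operator G R mv W a g h = (\<lambda>v. c *\<^sub>C v))"

definition eta ::
  "('g, 'm) monoid_scheme \<Rightarrow> ('g \<Rightarrow> 'h::chilbert_space \<Rightarrow> 'h) \<Rightarrow> 's set \<Rightarrow> ('g \<Rightarrow> 's \<Rightarrow> 's) \<Rightarrow>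
   ('s \<Rightarrow> 'g \<Rightarrow> 'h \<Rightarrow> 'h) \<Rightarrow> 'g \<times> 'g \<Rightarrow> 's \<Rightarrow> complex" where
  "eta G R S mv W = (\<lambda>(g, h)\<in>carrier G \<times> carrier G. \<lambda>a\<in>S.
     omega_scalar G R mv W (mv (inv\<^bsub>G\<^esub> (g \<otimes>\<^bsub>G\<^esub> h)) a) g h)"


section \<open>Group cohomology in degree two\<close>

definition G_module ::
  "('g, 'm) monoid_scheme \<Rightarrow> ('b, 'n) monoid_scheme \<Rightarrow> ('g \<Rightarrow> 'b \<Rightarrow> 'b) \<Rightarrow> bool" where
  "G_module G M act \<longleftrightarrow> comm_group M \<and> act \<in> hom G (AutoGroup M)"

definition cochains1 ::
  "('g, 'm) monoid_scheme \<Rightarrow> ('b, 'n) monoid_scheme \<Rightarrow> ('g \<Rightarrow> 'b) monoid" where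
  "cochains1 G M = product_group (carrier G) (\<lambda>_. M)"

definition cochains2 ::
  "('g, 'm) monoid_scheme \<Rightarrow> ('b, 'n) monoid_scheme \<Rightarrow> ('g \<times> 'g \<Rightarrow> 'b) monoid" where
  "cochains2 G M = product_group (carrier G \<times> carrier G) (\<lambda>_. M)"

definition coboundary1 ::
  "('g, 'm) monoid_scheme \<Rightarrow> ('b, 'n) monoid_scheme \<Rightarrow> ('g \<Rightarrow> 'b \<Rightarrow> 'b) \<Rightarrow>
   ('g \<Rightarrow> 'b) \<Rightarrow> 'g \<times> 'g \<Rightarrow> 'b" where
  "coboundary1 G M act b = (\<lambda>(g, h)\<in>carrier G \<times> carrier G.
     act g (b h) \<otimes>\<^bsub>M\<^esub> inv\<^bsub>M\<^esub> (b (g \<otimes>\<^bsub>G\<^esub> h)) \<otimes>\<^bsub>M\<^esub> b g)"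

definition cocycles2 ::
  "('g, 'm) monoid_scheme \<Rightarrow> ('b, 'n) monoid_scheme \<Rightarrow> ('g \<Rightarrow> 'b \<Rightarrow> 'b) \<Rightarrow> ('g \<times> 'g \<Rightarrow> 'b) set" where
  "cocycles2 G M act = {c \<in> carrier (cochains2 G M).
     \<forall>g\<in>carrier G. \<forall>h\<in>carrier G. \<forall>k\<in>carrier G.
       act g (c (h, k)) \<otimes>\<^bsub>M\<^esub> c (g, h \<otimes>\<^bsub>G\<^esub> k) = c (g \<otimes>\<^bsub>G\<^esub> h, k) \<otimes>\<^bsub>M\<^esub> c (g, h)}"

definition coboundaries2 ::
  "('g, 'm) monoid_scheme \<Rightarrow> ('b, 'n) monoid_scheme \<Rightarrow> ('g \<Rightarrow> 'b \<Rightarrow> 'b) \<Rightarrow> ('g \<times> 'g \<Rightarrow> 'b) set" where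
  "coboundaries2 G M act = coboundary1 G M act ` carrier (cochains1 G M)"

definition cocycle_group2 ::
  "('g, 'm) monoid_scheme \<Rightarrow> ('b, 'n) monoid_scheme \<Rightarrow> ('g \<Rightarrow> 'b \<Rightarrow> 'b) \<Rightarrow>
   ('g \<times> 'g \<Rightarrow> 'b) monoid" where
  "cocycle_group2 G M act = (cochains2 G M)\<lparr>carrier := cocycles2 G M act\<rparr>"

definition cohomology2 ::
  "('g, 'm) monoid_scheme \<Rightarrow> ('b, 'n) monoid_scheme \<Rightarrow> ('g \<Rightarrow> 'b \<Rightarrow> 'b) \<Rightarrow>
   ('g \<times> 'g \<Rightarrow> 'b) set monoid" where
  "cohomology2 G M act = cocycle_group2 G M act Mod coboundaries2 G M act"

definition cohomology_class2 ::
  "('g, 'm) monoid_scheme \<Rightarrow> ('b, 'n) monoid_scheme \<Rightarrow> ('g \<Rightarrow> 'b \<Rightarrow> 'b) \<Rightarrow>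
   ('g \<times> 'g \<Rightarrow> 'b) \<Rightarrow> ('g \<times> 'g \<Rightarrow> 'b) set" where
  "cohomology_class2 G M act c = coboundaries2 G M act #>\<^bsub>cocycle_group2 G M act\<^esub> c"

definition U1 :: "complex monoid" where
  "U1 = \<lparr>carrier = {z. cmod z = 1}, monoid.mult = (*), one = 1\<rparr>"

definition sector_module :: "'s set \<Rightarrow> ('s \<Rightarrow> complex) monoid" where
  "sector_module S = product_group S (\<lambda>_. U1)"

definition sector_action ::
  "('g, 'm) monoid_scheme \<Rightarrow> 's set \<Rightarrow> ('g \<Rightarrow> 's \<Rightarrow> 's) \<Rightarrow>
   'g \<Rightarrow> ('s \<Rightarrow> complex) \<Rightarrow> 's \<Rightarrow> complex" where
  "sector_action G S mv g = (\<lambda>x\<in>carrier (sector_module S). \<lambda>a\<in>S. x (mv (inv\<^bsub>G\<^esub> g) a))"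

end

theory Submission
  imports Defs
begin

text \<open>
  Both sides of the cocycle identity compare two factorisations of \<open>W a (g h k)\<close> that carry a
  representation to the same conjugate; by Schur's lemma they differ by a scalar. Schur's lemma is
  obtained without the spectral theorem: a square root argument shows that every self-adjoint
  operator in the commutant of an irreducible representation is positive or negative semidefinite,
  and applying this to its real translates leaves only scalars. That the symmetry acts on the
  sectors rests on the boundedness of *-representations (by the same square roots), which lets
  identities pass from the local algebras to their closures.
\<close>

section \<open>Complex vector spaces and inner products\<close>

text \<open>The scalars do not satisfy the ordinary cocycle identity at a fixed sector
  \<open>a\<close>: when the product is bracketed as \<open>(g h) k\<close>, the factor for
  \<open>(g, h)\<close> sits at the sector into which \<open>k\<close> has moved \<open>a\<close>.
  Reading every scalar at the sector moved back by the whole group element turns this drift into the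
  module action, which is the origin of the index in \<open>eta\<close>. Rephasing the unitaries by
  numbers \<open>z a g\<close> of modulus 1 multiplies \<open>eta\<close> by the coboundary of the
  inverse phases, read at an index shifted in the same way. A second obstacle is that \<beta> is
  prescribed only on local matrices, so its group law and its effect on regions have to be derived.
  They are obtained after composition with a representation, where continuity is at hand. Finally, a
  multiple of the identity determines its scalar only on a nonzero space; the normalisation of
  \<omega> supplies a nonzero vector.\<close>

lemma scaleC_one [simp]: "(1::complex) *\<^sub>C x = (x::'a::complex_normed_vector)"
  using scaleC_of_real[of 1 x] by simp

lemma scaleC_zero_left [simp]: "(0::complex) *\<^sub>C x = (0::'a::complex_normed_vector)"
  using scaleC_of_real[of 0 x] by simp

lemma scaleC_minus_one: "(- 1::complex) *\<^sub>C x = - (x::'a::complex_normed_vector)"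
  using scaleC_of_real[of "- 1" x] by simp

lemma scaleC_zero_right [simp]: "c *\<^sub>C (0::'a::complex_normed_vector) = 0"
  using scaleC_add_right[of c 0 0] by simp

lemma scaleC_eq_0_iff: "c *\<^sub>C x = 0 \<longleftrightarrow> c = 0 \<or> x = (0::'a::complex_normed_vector)"
  using norm_scaleC[of c x] by (metis mult_eq_0_iff norm_eq_zero)

lemma scaleC_right_cancel:
  "x \<noteq> (0::'a::complex_normed_vector) \<Longrightarrow> c *\<^sub>C x = c' *\<^sub>C x \<longleftrightarrow> c = c'"
  using scaleC_add_left[of "c - c'" c' x] by (auto simp: scaleC_eq_0_iff)

lemma clinear_map_imp_linear: "clinear_map T \<Longrightarrow> linear T"
  unfolding clinear_map_def by (intro linearI) (auto simp flip: scaleC_of_real)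

lemma bounded_operator_imp_linear: "bounded_operator T \<Longrightarrow> linear T"
  by (auto simp: bounded_operator_def clinear_map_imp_linear)

lemma bounded_operator_imp_bounded_linear: "bounded_operator T \<Longrightarrow> bounded_linear T"
  by (metis bounded_operator_def bounded_operator_imp_linear bounded_linear.intro
      bounded_linear_axioms.intro mult.commute)

lemma bounded_operator_scaleC: "bounded_operator T \<Longrightarrow> T (c *\<^sub>C v) = c *\<^sub>C T v"
  by (simp add: bounded_operator_def clinear_map_def)

lemma bounded_operator_add: "bounded_operator T \<Longrightarrow> T (v + w) = T v + T w"
  by (simp add: bounded_operator_def clinear_map_def)

lemma bounded_operator_comp:
  assumes "bounded_operator S" "bounded_operator T"
  shows "bounded_operator (S \<circ> T)"
proof -
  obtain K L where K: "\<And>v. norm (S v) \<le> K * norm v" and L: "\<And>v. norm (T v) \<le> L * norm v"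
    using assms by (auto simp: bounded_operator_def)
  have "norm (S (T v)) \<le> (\<bar>K\<bar> * L) * norm v" for v
  proof -
    have "norm (S (T v)) \<le> \<bar>K\<bar> * norm (T v)"
      using K[of "T v"] by (meson abs_ge_self mult_right_mono norm_ge_zero order_trans)
    also have "\<dots> \<le> \<bar>K\<bar> * (L * norm v)"
      using L by (intro mult_left_mono) auto
    finally show ?thesis by simp
  qed
  then show ?thesis
    using assms unfolding bounded_operator_def clinear_map_def by (auto intro!: exI[of _ "\<bar>K\<bar> * L"])
qed

lemma cinner_add_left: "cinner (x + y) z = cinner x z + cinner y (z::'h::chilbert_space)"
  using cinner_add_right[of z x y] by (metis cinner_commute complex_cnj_add)

lemma cinner_scaleC_left: "cinner (c *\<^sub>C x) z = cnj c * cinner x (z::'h::chilbert_space)"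
  using cinner_scaleC_right[of z c x] by (metis cinner_commute complex_cnj_mult)

lemma cinner_zero_right [simp]: "cinner x 0 = 0" for x :: "'h::chilbert_space"
  using cinner_add_right[of x 0 0] by simp

lemma cinner_zero_left [simp]: "cinner 0 x = 0" for x :: "'h::chilbert_space"
  using cinner_add_left[of 0 0 x] by simp

lemma cinner_minus_right [simp]: "cinner x (- y) = - cinner x y" for x :: "'h::chilbert_space"
  using cinner_add_right[of x y "- y"] by (simp add: eq_neg_iff_add_eq_0 add.commute)

lemma cinner_minus_left [simp]: "cinner (- x) y = - cinner x y" for x :: "'h::chilbert_space"
  using cinner_add_left[of x "- x" y] by (simp add: eq_neg_iff_add_eq_0 add.commute)

lemma cinner_diff_right: "cinner x (y - z) = cinner x y - cinner x z" for x :: "'h::chilbert_space"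
  using cinner_add_right[of x y "- z"] by simp

lemma cinner_diff_left: "cinner (x - y) z = cinner x z - cinner y z" for x :: "'h::chilbert_space"
  using cinner_add_left[of x "- y" z] by simp

lemma cinner_scaleR_right: "cinner x (r *\<^sub>R y) = r * cinner x y" for x :: "'h::chilbert_space"
  by (simp add: cinner_scaleC_right flip: scaleC_of_real)

lemma cinner_scaleR_left: "cinner (r *\<^sub>R x) y = r * cinner x y" for x :: "'h::chilbert_space"
  by (simp add: cinner_scaleC_left flip: scaleC_of_real)

lemma cinner_eqI:
  fixes x y :: "'h::chilbert_space"
  assumes "\<And>v. cinner v x = cinner v y"
  shows "x = y"
proof -
  have "cinner (x - y) (x - y) = 0"
    using assms[of "x - y"] by (simp add: cinner_diff_right)
  then show ?thesis by (simp add: cinner_self)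
qed

lemma norm_diff_square:
  "(norm (x - y))\<^sup>2 = (norm x)\<^sup>2 + (norm y)\<^sup>2 - 2 * Re (cinner x y)" for x :: "'h::chilbert_space"
proof -
  have "complex_of_real ((norm (x - y))\<^sup>2) =
      (norm x)\<^sup>2 + (norm y)\<^sup>2 - (cinner x y + cnj (cinner x y))"
    using cinner_commute[of y x] cinner_self[of x] cinner_self[of y] cinner_self[of "x - y"]
    by (simp add: cinner_diff_left cinner_diff_right algebra_simps)
  then have "Re (complex_of_real ((norm (x - y))\<^sup>2)) =
      Re ((norm x)\<^sup>2 + (norm y)\<^sup>2 - (cinner x y + cnj (cinner x y)))"
    by simp
  then show ?thesis by simp
qed


section \<open>Unitary operators\<close>

lemma unitary_operatorD:
  assumes "unitary_operator V"
  shows "bounded_operator V" "surj V" "cinner (V v) (V w) = cinner v w"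
  using assms by (auto simp: unitary_operator_def)

lemma unitary_norm: "unitary_operator V \<Longrightarrow> norm (V v) = norm v"
  using unitary_operatorD(3)[of V v v] unfolding cinner_self
  by (metis norm_ge_zero of_real_eq_iff power2_eq_imp_eq)

lemma unitary_bij: "unitary_operator V \<Longrightarrow> bij V"
proof (rule bijI)
  assume V: "unitary_operator V"
  have "V v = V w \<Longrightarrow> v = w" for v w
    using unitary_norm[OF V, of "v - w"]
      bounded_operator_imp_linear[OF unitary_operatorD(1)[OF V]] by (simp add: linear_diff)
  then show "inj V" by (rule injI)
qed (rule unitary_operatorD(2))

text \<open>\<open>hadj\<close> is a definite description, so it is controlled only once an adjoint
  is exhibited. For a unitary the inverse is a witness, and nondegeneracy of the inner product makes
  it unique.\<close>

lemma hadj_unitary: "unitary_operator V \<Longrightarrow> hadj V = inv_into UNIV V"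
  unfolding hadj_def
proof (rule the_equality)
  assume V: "unitary_operator V"
  then have inv: "V (inv_into UNIV V w) = w" for w
    by (simp add: unitary_operatorD(2) surj_f_inv_f)
  show *: "\<forall>v w. cinner (V v) w = cinner v (inv_into UNIV V w)"
    using unitary_operatorD(3)[OF V] inv by metis
  fix S assume S: "\<forall>v w. cinner (V v) w = cinner v (S w)"
  show "S = inv_into UNIV V"
  proof
    fix w
    show "S w = inv_into UNIV V w" by (rule cinner_eqI) (metis S *)
  qed
qed

lemma hadj_right [simp]: "unitary_operator V \<Longrightarrow> V (hadj V v) = v"
  by (simp add: hadj_unitary unitary_operatorD(2) surj_f_inv_f)

lemma hadj_left [simp]: "unitary_operator V \<Longrightarrow> hadj V (V v) = v"
  by (simp add: hadj_unitary unitary_bij bij_is_inj)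

lemma cinner_hadj: "unitary_operator V \<Longrightarrow> cinner (V v) w = cinner v (hadj V w)"
  using unitary_operatorD(3)[of V v "hadj V w"] by simp

text \<open>By surjectivity every test vector has the form \<open>V u'\<close>, and removing
  \<open>V\<close> from the inner product reduces linearity of \<open>V\<close> to linearity of the
  inner product. Composites and adjoints can thus be checked through two conditions.\<close>

lemma unitary_operatorI:
  assumes "surj V" "\<And>v w. cinner (V v) (V w) = cinner v w"
  shows "unitary_operator V"
proof -
  have add: "V (v + w) = V v + V w" for v w
  proof (rule cinner_eqI)
    fix u
    obtain u' where "u = V u'" using assms(1) by (metis surjD)
    then show "cinner u (V (v + w)) = cinner u (V v + V w)"
      by (simp add: assms(2) cinner_add_right)
  qed
  have scale: "V (c *\<^sub>C v) = c *\<^sub>C V v" for c v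
  proof (rule cinner_eqI)
    fix u
    obtain u' where "u = V u'" using assms(1) by (metis surjD)
    then show "cinner u (V (c *\<^sub>C v)) = cinner u (c *\<^sub>C V v)"
      by (simp add: assms(2) cinner_scaleC_right)
  qed
  have "norm (V v) \<le> 1 * norm v" for v
    using assms(2)[of v v] unfolding cinner_self
    by (metis mult_1 norm_ge_zero of_real_eq_iff order_refl power2_eq_imp_eq)
  then show ?thesis
    using assms add scale unfolding unitary_operator_def bounded_operator_def clinear_map_def by blast
qed

lemma unitary_comp: "unitary_operator V \<Longrightarrow> unitary_operator W \<Longrightarrow> unitary_operator (V \<circ> W)"
  by (rule unitary_operatorI) (simp_all only: unitary_operatorD(2,3) comp_surj comp_apply)

lemma unitary_hadj: "unitary_operator V \<Longrightarrow> unitary_operator (hadj V)"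
  by (rule unitary_operatorI) (metis hadj_left surjI, metis hadj_right unitary_operatorD(3))

lemma hadj_hadj: "unitary_operator V \<Longrightarrow> hadj (hadj V) = V"
  by (rule ext) (metis hadj_left hadj_right unitary_hadj)

lemma hadj_comp:
  "unitary_operator V \<Longrightarrow> unitary_operator W \<Longrightarrow> hadj (V \<circ> W) = hadj W \<circ> hadj V"
  by (simp add: hadj_unitary unitary_comp unitary_bij o_inv_distrib)

lemma unitary_id: "unitary_operator (\<lambda>v. v)"
  by (rule unitary_operatorI) (auto intro: surjI)

lemma hadj_id: "hadj (\<lambda>v::'h::chilbert_space. v) = (\<lambda>v. v)"
  by (rule ext) (metis hadj_left[OF unitary_id])

lemma unitary_cancel [simp]: "unitary_operator V \<Longrightarrow> V v = V w \<longleftrightarrow> v = w"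
  by (metis hadj_left)

lemma Ad_comp:
  "unitary_operator V \<Longrightarrow> unitary_operator W \<Longrightarrow> Ad (V \<circ> W) T = Ad V (Ad W T)"
  by (simp add: Ad_def hadj_comp fun_eq_iff)

lemma Ad_hadj_Ad [simp]: "unitary_operator V \<Longrightarrow> Ad (hadj V) (Ad V T) = T"
  by (simp add: Ad_def hadj_hadj fun_eq_iff)

section \<open>Square roots\<close>

text \<open>
  The iteration \<open>Y \<mapsto> (C + Y\<^sup>2) / 2\<close>, started at \<open>0\<close>, converges to a \<open>Y\<close> with
  \<open>(1 - Y)\<^sup>2 = 1 - C\<close>. Its increments are dominated by those of the same iteration for \<open>C = 1\<close>.
\<close>

primrec sqrt_iter :: "('a::real_normed_vector \<Rightarrow> 'a) \<Rightarrow> nat \<Rightarrow> 'a \<Rightarrow> 'a" where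
  "sqrt_iter C 0 v = 0"
| "sqrt_iter C (Suc n) v = (1/2) *\<^sub>R (C v + sqrt_iter C n (sqrt_iter C n v))"

primrec sqrt_bound :: "nat \<Rightarrow> real" where
  "sqrt_bound 0 = 0"
| "sqrt_bound (Suc n) = (1 + (sqrt_bound n)\<^sup>2) / 2"

definition sqrt_limit :: "('a::real_normed_vector \<Rightarrow> 'a) \<Rightarrow> 'a \<Rightarrow> 'a" where
  "sqrt_limit C v = lim (\<lambda>n. sqrt_iter C n v)"

lemma sqrt_bound_nonneg: "0 \<le> sqrt_bound n"
  by (cases n) auto

lemma sqrt_bound_le_1: "sqrt_bound n \<le> 1"
proof (induction n)
  case (Suc n)
  then have "(sqrt_bound n)\<^sup>2 \<le> 1" using sqrt_bound_nonneg by (simp add: abs_square_le_1)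
  then show ?case by simp
qed simp

lemma sqrt_bound_mono: "sqrt_bound n \<le> sqrt_bound (Suc n)"
proof -
  have "0 \<le> (1 - sqrt_bound n)\<^sup>2" by simp
  then show ?thesis by (simp add: power2_eq_square algebra_simps)
qed

lemma sqrt_bound_convergent: "convergent sqrt_bound"
  using sqrt_bound_mono sqrt_bound_le_1 sqrt_bound_nonneg
  by (intro Bseq_monoseq_convergent BseqI'[of _ 1]) (auto simp: monoseq_Suc)

lemma linear_sqrt_iter:
  assumes "linear C"
  shows "linear (sqrt_iter C n)"
proof (induction n)
  case 0
  then show ?case by (auto intro: linearI)
next
  case (Suc n)
  then show ?case using assms
    by (auto intro!: linearI simp: linear_add linear_scale scaleR_add_right algebra_simps)
qed

text \<open>Each iterate is a real polynomial in \<open>C\<close>. Taking an iterate for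
  \<open>T\<close> shows that the iterates commute with one another.\<close>

lemma sqrt_iter_commute:
  assumes "linear T" "\<And>v. T (C v) = C (T v)"
  shows "T (sqrt_iter C n v) = sqrt_iter C n (T v)"
  using assms by (induction n arbitrary: v) (simp_all add: linear_0 linear_add linear_scale)

context
  fixes C :: "'a::{real_normed_vector,complete_space} \<Rightarrow> 'a"
  assumes lin: "linear C" and bound: "\<And>v. norm (C v) \<le> norm v"
begin

lemma norm_sqrt_iter: "norm (sqrt_iter C n v) \<le> sqrt_bound n * norm v"
proof (induction n arbitrary: v)
  case (Suc n)
  have "norm (sqrt_iter C n (sqrt_iter C n v)) \<le> sqrt_bound n * (sqrt_bound n * norm v)"
    using Suc sqrt_bound_nonneg by (meson mult_left_mono order_trans)
  then show ?case
    using bound[of v] norm_triangle_ineq[of "C v" "sqrt_iter C n (sqrt_iter C n v)"]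
    by (simp add: power2_eq_square algebra_simps flip: scaleR_add_right)
qed simp

text \<open>For commuting iterates the difference of squares factors, so the next increment at
  \<open>v\<close> is half the present increment at \<open>Q' v + Q v\<close>; hence the induction
  over arbitrary vectors. The recursion for \<open>sqrt_bound\<close> factors in the same
  way.\<close>

lemma norm_sqrt_iter_increment:
  "norm (sqrt_iter C (Suc n) v - sqrt_iter C n v) \<le> (sqrt_bound (Suc n) - sqrt_bound n) * norm v"
proof (induction n arbitrary: v)
  case 0
  then show ?case using bound[of v] by simp
next
  case (Suc n)
  let ?Q = "sqrt_iter C n" and ?Q' = "sqrt_iter C (Suc n)"
  let ?q = "sqrt_bound n" and ?q' = "sqrt_bound (Suc n)"
  note lins = linear_sqrt_iter[OF lin]
  have comm: "?Q (?Q' v) = ?Q' (?Q v)"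
    by (intro sqrt_iter_commute lins) (metis lin sqrt_iter_commute)
  have "sqrt_iter C (Suc (Suc n)) v - ?Q' v = (1/2) *\<^sub>R (?Q' (?Q' v) - ?Q (?Q v))"
    unfolding sqrt_iter.simps(2)[of C "Suc n"] sqrt_iter.simps(2)[of C n v]
    by (simp add: algebra_simps del: sqrt_iter.simps)
  also have "?Q' (?Q' v) - ?Q (?Q v) = ?Q' (?Q' v + ?Q v) - ?Q (?Q' v + ?Q v)"
    by (simp add: linear_add[OF lins] comm del: sqrt_iter.simps)
  finally have "norm (sqrt_iter C (Suc (Suc n)) v - ?Q' v) =
      (1/2) * norm (?Q' (?Q' v + ?Q v) - ?Q (?Q' v + ?Q v))"
    by (simp del: sqrt_iter.simps)
  also have "\<dots> \<le> (1/2) * ((?q' - ?q) * norm (?Q' v + ?Q v))"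
    using Suc[of "?Q' v + ?Q v"] by linarith
  also have "\<dots> \<le> (1/2) * ((?q' - ?q) * ((?q' + ?q) * norm v))"
    using norm_sqrt_iter[of "Suc n" v] norm_sqrt_iter[of n v] sqrt_bound_mono[of n]
      norm_triangle_ineq[of "?Q' v" "?Q v"]
    by (intro mult_left_mono) (auto simp: distrib_right simp del: sqrt_iter.simps sqrt_bound.simps)
  also have "\<dots> = (sqrt_bound (Suc (Suc n)) - ?q') * norm v"
    unfolding sqrt_bound.simps(2)[of "Suc n"]
    by (simp add: power2_eq_square field_simps)
  finally show ?case .
qed

lemma sqrt_iter_convergent: "convergent (\<lambda>n. sqrt_iter C n v)"
proof -
  have diff: "norm (sqrt_iter C n v - sqrt_iter C m v) \<le> (sqrt_bound n - sqrt_bound m) * norm v"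
    if "m \<le> n" for m n
    using that
  proof (induction n rule: dec_induct)
    case (step n)
    have "norm (sqrt_iter C (Suc n) v - sqrt_iter C m v) \<le>
        norm (sqrt_iter C (Suc n) v - sqrt_iter C n v) + norm (sqrt_iter C n v - sqrt_iter C m v)"
      using norm_triangle_ineq[of "sqrt_iter C (Suc n) v - sqrt_iter C n v"
          "sqrt_iter C n v - sqrt_iter C m v"] by simp
    also have "\<dots> \<le> (sqrt_bound (Suc n) - sqrt_bound m) * norm v"
      using norm_sqrt_iter_increment[of n v] step.IH by (simp add: algebra_simps)
    finally show ?case .
  qed simp
  have "Cauchy (\<lambda>n. sqrt_iter C n v)"
  proof (rule CauchyI')
    fix e :: real assume e: "0 < e"
    have "Cauchy sqrt_bound" using sqrt_bound_convergent by (rule convergent_Cauchy)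
    \<comment> \<open>The summand 1 keeps the divisor positive when \<open>v\<close> is
      zero.\<close>
    then obtain M where M: "\<And>m n. M \<le> m \<Longrightarrow> M \<le> n \<Longrightarrow>
        dist (sqrt_bound m) (sqrt_bound n) < e / (norm v + 1)"
      using e by (metis Cauchy_def add_nonneg_pos divide_pos_pos norm_ge_zero zero_less_one)
    show "\<exists>M. \<forall>m\<ge>M. \<forall>n>m. dist (sqrt_iter C m v) (sqrt_iter C n v) < e"
    proof (intro exI allI impI)
      fix m n assume "M \<le> m" "m < n"
      then have "sqrt_bound n - sqrt_bound m < e / (norm v + 1)"
        using M[of m n] by (simp add: dist_real_def)
      then have "(sqrt_bound n - sqrt_bound m) * (norm v + 1) < e"
        by (simp add: pos_less_divide_eq add_nonneg_pos)
      moreover have "sqrt_bound m \<le> sqrt_bound n"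
        using \<open>m < n\<close> sqrt_bound_mono by (simp add: lift_Suc_mono_le del: sqrt_bound.simps)
      ultimately show "dist (sqrt_iter C m v) (sqrt_iter C n v) < e"
        using diff[of m n] \<open>m < n\<close> by (simp add: dist_norm norm_minus_commute algebra_simps)
    qed
  qed
  then show ?thesis by (rule Cauchy_convergent)
qed

lemma sqrt_iter_tendsto: "(\<lambda>n. sqrt_iter C n v) \<longlonglongrightarrow> sqrt_limit C v"
  unfolding sqrt_limit_def using sqrt_iter_convergent by (simp add: convergent_LIMSEQ_iff)

lemma norm_sqrt_limit: "norm (sqrt_limit C v) \<le> norm v"
proof (rule LIMSEQ_le_const2[OF tendsto_norm[OF sqrt_iter_tendsto]])
  show "\<exists>N. \<forall>n\<ge>N. norm (sqrt_iter C n v) \<le> norm v"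
    using norm_sqrt_iter[of _ v] sqrt_bound_le_1
    by (meson mult_left_le_one_le norm_ge_zero order_trans sqrt_bound_nonneg)
qed

lemma linear_sqrt_limit: "linear (sqrt_limit C)"
proof (rule linearI)
  note lins = linear_sqrt_iter[OF lin]
  show "sqrt_limit C (v + w) = sqrt_limit C v + sqrt_limit C w" for v w
    using tendsto_add[OF sqrt_iter_tendsto[of v] sqrt_iter_tendsto[of w]] sqrt_iter_tendsto[of "v + w"]
    by (simp add: linear_add[OF lins] LIMSEQ_unique)
  show "sqrt_limit C (r *\<^sub>R v) = r *\<^sub>R sqrt_limit C v" for r v
    using tendsto_scaleR[OF tendsto_const sqrt_iter_tendsto[of v]] sqrt_iter_tendsto[of "r *\<^sub>R v"]
    by (simp add: linear_scale[OF lins] LIMSEQ_unique)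
qed

lemma sqrt_limit_commute:
  assumes "bounded_linear T" "\<And>v. T (C v) = C (T v)"
  shows "T (sqrt_limit C v) = sqrt_limit C (T v)"
proof -
  have "(\<lambda>n. T (sqrt_iter C n v)) \<longlonglongrightarrow> T (sqrt_limit C v)"
    using assms(1) sqrt_iter_tendsto by (rule bounded_linear.tendsto)
  moreover have "T (sqrt_iter C n v) = sqrt_iter C n (T v)" for n
    using assms bounded_linear.linear by (intro sqrt_iter_commute)
  ultimately show ?thesis using sqrt_iter_tendsto[of "T v"] by (simp add: LIMSEQ_unique)
qed

text \<open>Convergence is pointwise in \<open>v\<close>, so passing to the limit in the square
  needs uniformity: the iterates are contractions, hence \<open>Q n (Q n v)\<close> differs from
  \<open>Q n (Y v)\<close> by at most the distance from \<open>Q n v\<close> to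
  \<open>Y v\<close>.\<close>

lemma sqrt_limit_eq: "sqrt_limit C v = (1/2) *\<^sub>R (C v + sqrt_limit C (sqrt_limit C v))"
proof -
  let ?Y = "sqrt_limit C" and ?Q = "sqrt_iter C"
  note lins = linear_sqrt_iter[OF lin]
  have "(\<lambda>n. ?Q n (?Q n v - ?Y v)) \<longlonglongrightarrow> 0"
  proof (rule Lim_null_comparison)
    show "\<forall>\<^sub>F n in sequentially. norm (?Q n (?Q n v - ?Y v)) \<le> norm (?Q n v - ?Y v)"
      using norm_sqrt_iter sqrt_bound_le_1 sqrt_bound_nonneg
      by (intro always_eventually) (meson mult_left_le_one_le norm_ge_zero order_trans)
    show "(\<lambda>n. norm (?Q n v - ?Y v)) \<longlonglongrightarrow> 0"
      using sqrt_iter_tendsto[of v] by (simp add: LIM_zero tendsto_norm_zero)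
  qed
  from tendsto_add[OF this sqrt_iter_tendsto[of "?Y v"]]
  have "(\<lambda>n. ?Q n (?Q n v)) \<longlonglongrightarrow> ?Y (?Y v)"
    by (simp add: linear_diff[OF lins])
  then have "(\<lambda>n. ?Q (Suc n) v) \<longlonglongrightarrow> (1/2) *\<^sub>R (C v + ?Y (?Y v))"
    by (simp add: tendsto_add tendsto_scaleR)
  moreover have "(\<lambda>n. ?Q (Suc n) v) \<longlonglongrightarrow> ?Y v"
    using sqrt_iter_tendsto by (rule LIMSEQ_Suc)
  ultimately show ?thesis by (rule LIMSEQ_unique[symmetric])
qed

end

section \<open>Representations\<close>

lemma representationD:
  assumes "representation \<rho>"
  shows "bounded_operator (\<rho> x)" "\<rho> (x + y) v = \<rho> x v + \<rho> y v" "\<rho> (c *\<^sub>C x) v = c *\<^sub>C \<rho> x v"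
    "\<rho> (x * y) v = \<rho> x (\<rho> y v)" "cinner (\<rho> x v) w = cinner v (\<rho> (star x) w)"
  using assms by (auto simp: representation_def)

section \<open>Involution and square roots in a C*-algebra\<close>

lemma star_zero [simp]: "star (0::'a::cstar_algebra) = 0"
  using star_add[of 0 0] by simp

lemma star_one [simp]: "star (1::'a::cstar_algebra) = 1"
  by (metis mult.left_neutral mult.right_neutral star_mult star_star)

lemma star_scaleR: "star (r *\<^sub>R x) = r *\<^sub>R star (x::'a::cstar_algebra)"
  using star_scaleC[of "complex_of_real r" x] by (simp add: scaleC_of_real)

lemma star_diff: "star (x - y) = star x - star (y::'a::cstar_algebra)"
  using star_add[of "x - y" y] by simp

lemma norm_star [simp]: "norm (star x) = norm (x::'a::cstar_algebra)"
proof -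
  have "norm x \<le> norm (star x)" for x :: 'a
  proof (cases "norm x = 0")
    case False
    have "norm x * norm x \<le> norm (star x) * norm x"
      using cstar_identity[of x] norm_mult_ineq[of "star x" x] by (simp add: power2_eq_square)
    then show ?thesis using False by simp
  qed simp
  from this[of x] this[of "star x"] show ?thesis by (simp add: star_star)
qed

lemma star_tendsto:
  fixes f :: "nat \<Rightarrow> 'a::cstar_algebra"
  assumes "f \<longlonglongrightarrow> l"
  shows "(\<lambda>n. star (f n)) \<longlonglongrightarrow> star l"
proof -
  have "(\<lambda>n. norm (star (f n) - star l)) \<longlonglongrightarrow> 0"
    using assms by (simp add: tendsto_norm_zero_iff LIM_zero_iff flip: star_diff)
  then show ?thesis by (simp add: tendsto_norm_zero_iff LIM_zero_iff)
qed

text \<open>The iteration runs on the algebra itself, with left multiplication by \<open>h\<close>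
  as \<open>C\<close>. Its iterates are left multiplications by their values at 1, which are
  self-adjoint, and so is the limit of these values.\<close>

lemma cstar_sqrt:
  fixes h :: "'a::cstar_algebra"
  assumes "star h = h" "norm h \<le> 1"
  obtains s where "star s = s" "s * s = 1 - h"
proof -
  define C where "C = (\<lambda>a. h * a)"
  have lin: "linear C" by (auto intro: linearI simp: C_def distrib_left)
  have bound: "norm (C a) \<le> norm a" for a
    using norm_mult_ineq[of h a] assms(2) mult_right_mono[OF assms(2), of "norm a"] by (simp add: C_def)
  have "sqrt_iter C n a = sqrt_iter C n 1 * a \<and> star (sqrt_iter C n 1) = sqrt_iter C n 1" for n a
  proof (induction n arbitrary: a)
    case (Suc n)
    then have *: "sqrt_iter C n a = sqrt_iter C n 1 * a" "star (sqrt_iter C n 1) = sqrt_iter C n 1" for a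
      by blast+
    have "sqrt_iter C n (sqrt_iter C n a) = sqrt_iter C n 1 * sqrt_iter C n 1 * a" for a
      by (metis * mult.assoc)
    then show ?case
      using assms(1) *(2) by (simp add: C_def star_scaleR star_add star_mult distrib_right)
  qed simp
  then have mult: "sqrt_iter C n a = sqrt_iter C n 1 * a"
    and star: "star (sqrt_iter C n 1) = sqrt_iter C n 1" for n a
    by blast+
  define y where "y = sqrt_limit C 1"
  have y: "(\<lambda>n. sqrt_iter C n 1) \<longlonglongrightarrow> y"
    unfolding y_def using lin bound by (rule sqrt_iter_tendsto)
  \<comment> \<open>Evaluating at \<open>y\<close> identifies the composite of the limit map with
    itself at 1 with the algebra product \<open>y * y\<close>.\<close>
  have "(\<lambda>n. sqrt_iter C n y) \<longlonglongrightarrow> y * y"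
    unfolding mult[of _ y] using y by (intro tendsto_mult tendsto_const)
  then have "sqrt_limit C y = y * y"
    using sqrt_iter_tendsto[OF lin bound] LIMSEQ_unique by blast
  then have "y = (1/2) *\<^sub>R (h + y * y)"
    using sqrt_limit_eq[OF lin bound, of 1] by (simp add: C_def y_def)
  then have "2 *\<^sub>R y = h + y * y"
    by (metis scaleR_scaleR divide_self_if mult.commute scaleR_one times_divide_eq_right zero_neq_numeral mult.right_neutral)
  then have "(1 - y) * (1 - y) = 1 - h"
    by (simp add: algebra_simps scaleR_2)
  moreover have "star y = y"
    using star_tendsto[OF y] y unfolding star by (rule LIMSEQ_unique)
  ultimately show thesis using that[of "1 - y"] by (simp add: star_diff)
qed

text \<open>After scaling, 1 minus \<open>star x * x\<close> is the square of a self-adjoint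
  element, and \<rho> turns this into the square of a norm, which is nonnegative. The bound contains
  \<open>norm (\<rho> 1 v)\<close> because \<open>\<rho> 1\<close> may be a proper
  projection.\<close>

lemma representation_norm:
  assumes rep: "representation \<rho>"
  shows "norm (\<rho> x v) \<le> norm x * norm (\<rho> 1 v)"
proof (cases "x = 0")
  case True
  then show ?thesis using representationD(2)[OF rep, of 0 0 v] by simp
next
  case False
  \<comment> \<open>This factor scales \<open>star x * x\<close> to norm 1, within the range of
    \<open>cstar_sqrt\<close>.\<close>
  define t :: real where "t = 1 / (norm x)\<^sup>2"
  have sq: "(norm (\<rho> y v))\<^sup>2 = Re (cinner v (\<rho> (star y * y) v))" for y
    using representationD(5)[OF rep, of y v "\<rho> y v"]
    by (metis cinner_self representationD(4)[OF rep] Re_complex_of_real)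
  have "star (t *\<^sub>R (star x * x)) = t *\<^sub>R (star x * x)"
    by (simp add: star_scaleR star_mult star_star)
  moreover have "norm (t *\<^sub>R (star x * x)) \<le> 1"
    using False by (simp add: cstar_identity t_def)
  ultimately obtain s where s: "star s = s" "s * s = 1 - t *\<^sub>R (star x * x)"
    by (rule cstar_sqrt)
  have scale: "\<rho> (r *\<^sub>R y) v = r *\<^sub>R \<rho> y v" for r y
    using representationD(3)[OF rep, of "complex_of_real r"] by (simp add: scaleC_of_real)
  have diff: "\<rho> (a - b) v = \<rho> a v - \<rho> b v" for a b
    using representationD(2)[OF rep, of "a - b" b v] by simp
  have "0 \<le> (norm (\<rho> s v))\<^sup>2" by simp
  also have "\<dots> = Re (cinner v (\<rho> 1 v)) - t * Re (cinner v (\<rho> (star x * x) v))"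
    unfolding sq s by (simp add: scale diff cinner_diff_right cinner_scaleR_right)
  also have "\<dots> = (norm (\<rho> 1 v))\<^sup>2 - t * (norm (\<rho> x v))\<^sup>2"
    unfolding sq by simp
  finally have "(norm (\<rho> x v))\<^sup>2 \<le> (norm x * norm (\<rho> 1 v))\<^sup>2"
    using False by (simp add: t_def field_simps power_mult_distrib)
  then show ?thesis by (rule power2_le_imp_le) simp
qed

lemma representation_continuous:
  assumes rep: "representation \<rho>"
  shows "continuous_on UNIV (\<lambda>x. \<rho> x v)"
proof -
  have "bounded_linear (\<lambda>x. \<rho> x v)"
  proof (rule bounded_linear_intro)
    show "\<rho> (x + y) v = \<rho> x v + \<rho> y v" for x y using rep by (rule representationD)
    show "\<rho> (r *\<^sub>R x) v = r *\<^sub>R \<rho> x v" for r x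
      using representationD(3)[OF rep, of "complex_of_real r"] by (simp add: scaleC_of_real)
    show "norm (\<rho> x v) \<le> norm x * norm (\<rho> 1 v)" for x using rep by (rule representation_norm)
  qed
  then show ?thesis by (rule linear_continuous_on)
qed

text \<open>For each fixed vector, the set where both representations act alike is closed by
  continuity. Every passage from local matrices to a limit algebra goes through this fact.\<close>

lemma representations_eq_on_closure:
  assumes "representation \<rho>" "representation \<sigma>" "\<And>x. x \<in> D \<Longrightarrow> \<rho> x = \<sigma> x" "x \<in> closure D"
  shows "\<rho> x = \<sigma> x"
proof
  fix v
  have "closed {x. \<rho> x v = \<sigma> x v}"
    using assms(1,2) by (intro closed_Collect_eq representation_continuous)
  then have "closure D \<subseteq> {x. \<rho> x v = \<sigma> x v}"
    using assms(3) by (intro closure_minimal) auto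
  then show "\<rho> x v = \<sigma> x v" using assms(4) by auto
qed

section \<open>Representations composed with automorphisms and conjugated by unitaries\<close>

lemma representation_comp_automorphism:
  "representation \<rho> \<Longrightarrow> star_automorphism f \<Longrightarrow> representation (\<lambda>x. \<rho> (f x))"
  by (auto simp: representation_def star_automorphism_def)

lemma bounded_operator_Ad:
  "unitary_operator V \<Longrightarrow> bounded_operator T \<Longrightarrow> bounded_operator (Ad V T)"
  by (simp add: Ad_def bounded_operator_comp unitary_hadj unitary_operatorD(1))

lemma representation_Ad:
  assumes V: "unitary_operator V" and rep: "representation \<rho>"
  shows "representation (\<lambda>x. Ad V (\<rho> x))"
  unfolding representation_def
proof (intro conjI allI)
  note R = representationD[OF rep] and VD = unitary_operatorD(1)[OF V]
  show "bounded_operator (Ad V (\<rho> x))" for x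
    using V R(1) by (rule bounded_operator_Ad)
  show "Ad V (\<rho> (x + y)) v = Ad V (\<rho> x) v + Ad V (\<rho> y) v" for x y v
    by (simp add: Ad_def R(2) bounded_operator_add[OF VD])
  show "Ad V (\<rho> (c *\<^sub>C x)) v = c *\<^sub>C Ad V (\<rho> x) v" for c x v
    by (simp add: Ad_def R(3) bounded_operator_scaleC[OF VD])
  show "Ad V (\<rho> (x * y)) = Ad V (\<rho> x) \<circ> Ad V (\<rho> y)" for x y
    using V by (simp add: Ad_def R(4) fun_eq_iff)
  show "cinner (Ad V (\<rho> x) v) w = cinner v (Ad V (\<rho> (star x)) w)" for x v w
    using V cinner_hadj[OF V] cinner_hadj[OF unitary_hadj[OF V]]
    by (simp add: Ad_def R(5) hadj_hadj)
qed

section \<open>Schur's lemma\<close>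

text \<open>The kernel of an operator in the commutant is a closed invariant subspace. This is the
  form in which irreducibility enters Schur's lemma.\<close>

lemma kernel_invariant_subspace:
  assumes irr: "irreducible_rep \<rho>" and T: "bounded_operator T"
    and comm: "\<And>x v. T (\<rho> x v) = \<rho> x (T v)" and zero: "\<And>x. \<rho> x 0 = 0"
  shows "{v. T v = 0} = {0} \<or> (\<forall>v. T v = 0)"
proof -
  have "csubspace {v. T v = 0}"
    using linear_0[OF bounded_operator_imp_linear[OF T]] T
    by (simp add: csubspace_def bounded_operator_add bounded_operator_scaleC)
  moreover have "closed {v. T v = 0}"
    using bounded_operator_imp_bounded_linear[OF T]
    by (intro closed_Collect_eq linear_continuous_on) (auto intro: continuous_on_const)
  moreover have "\<rho> x ` {v. T v = 0} \<subseteq> {v. T v = 0}" for x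
    using comm zero by auto
  ultimately show ?thesis using irr unfolding irreducible_rep_def by blast
qed

lemma bounded_operator_combination:
  assumes S: "bounded_operator S" and T: "bounded_operator T"
  shows "bounded_operator (\<lambda>v. c *\<^sub>C S v + d *\<^sub>C T v)"
proof -
  obtain K L where K: "\<And>v. norm (S v) \<le> K * norm v" and L: "\<And>v. norm (T v) \<le> L * norm v"
    using assms by (auto simp: bounded_operator_def)
  have "norm (c *\<^sub>C S v + d *\<^sub>C T v) \<le> (cmod c * K + cmod d * L) * norm v" for v
    using norm_triangle_ineq[of "c *\<^sub>C S v" "d *\<^sub>C T v"]
      mult_left_mono[OF K[of v], of "cmod c"] mult_left_mono[OF L[of v], of "cmod d"]
    by (simp add: norm_scaleC algebra_simps)
  then show ?thesis
    unfolding bounded_operator_def clinear_map_def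
    using assms
    by (auto simp: bounded_operator_add bounded_operator_scaleC scaleC_add_right scaleC_scaleC
        mult.commute[of c] mult.commute[of d])
qed

lemma bounded_operator_id: "bounded_operator (\<lambda>v. v)"
  using unitary_id by (rule unitary_operatorD)

text \<open>
  With \<open>S = \<surd>(B\<^sup>2)\<close>, the operators \<open>S - B\<close> and \<open>S + B\<close> have product \<open>0\<close> and commute with the
  representation, so irreducibility forces \<open>B = S\<close> or \<open>B = -S\<close>.
\<close>

lemma schur_semidefinite:
  fixes \<rho> :: "'a::cstar_algebra \<Rightarrow> 'h::chilbert_space \<Rightarrow> 'h"
  assumes irr: "irreducible_rep \<rho>" and rep: "representation \<rho>"
    and B: "bounded_operator B" and contr: "\<And>v. norm (B v) \<le> norm v"
    and sa: "\<And>v w. cinner (B v) w = cinner v (B w)"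
    and comm: "\<And>x v. B (\<rho> x v) = \<rho> x (B v)"
  shows "(\<forall>v. 0 \<le> Re (cinner v (B v))) \<or> (\<forall>v. Re (cinner v (B v)) \<le> 0)"
proof -
  define C where "C = (\<lambda>v. v - B (B v))"
  define S where "S = (\<lambda>v. v - sqrt_limit C v)"
  note linB = bounded_operator_imp_linear[OF B]
  have C_alt: "C = (\<lambda>v. 1 *\<^sub>C v + (- 1) *\<^sub>C (B \<circ> B) v)"
    by (simp add: C_def scaleC_minus_one)
  have opC: "bounded_operator C"
    unfolding C_alt using B by (intro bounded_operator_combination bounded_operator_comp bounded_operator_id)
  note lin = bounded_operator_imp_linear[OF opC]
  have bound: "norm (C v) \<le> norm v" for v
  proof -
    \<comment> \<open>Self-adjointness turns the cross term into the squared norm of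
      \<open>B v\<close>, and contractivity at \<open>B v\<close> makes the last two terms
      nonpositive together.\<close>
    have "(norm (C v))\<^sup>2 = (norm v)\<^sup>2 + (norm (B (B v)))\<^sup>2 - 2 * (norm (B v))\<^sup>2"
      using sa[of v "B v", symmetric] by (simp add: C_def norm_diff_square cinner_self)
    also have "\<dots> \<le> (norm v)\<^sup>2"
      using power_mono[OF contr[of "B v"] norm_ge_zero, of 2] zero_le_power2[of "norm (B v)"] by linarith
    finally show ?thesis by (rule power2_le_imp_le) simp
  qed
  have commute: "T (sqrt_limit C v) = sqrt_limit C (T v)"
    if "bounded_operator T" "\<And>v. T (B v) = B (T v)" for T v
    using that bounded_operator_imp_bounded_linear[OF that(1)] bounded_operator_imp_linear[OF that(1)]
    by (intro sqrt_limit_commute lin bound) (auto simp: C_def linear_diff)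
  note linY = linear_sqrt_limit[OF lin bound]
  \<comment> \<open>The construction gives real linearity. Complex homogeneity follows because
    scaling by \<open>c\<close> is a bounded operator commuting with \<open>B\<close>.\<close>
  have "sqrt_limit C (c *\<^sub>C v) = c *\<^sub>C sqrt_limit C v" for c v
    using bounded_operator_combination[OF bounded_operator_id bounded_operator_id, of c 0]
    by (intro commute[of "\<lambda>v. c *\<^sub>C v", symmetric]) (simp_all add: bounded_operator_scaleC[OF B])
  moreover have "norm (sqrt_limit C v) \<le> 1 * norm v" for v
    using norm_sqrt_limit[OF lin bound] by simp
  ultimately have opY: "bounded_operator (sqrt_limit C)"
    using linY unfolding bounded_operator_def clinear_map_def by (blast intro: linear_add)
  have S_alt: "S = (\<lambda>v. 1 *\<^sub>C v + (- 1) *\<^sub>C sqrt_limit C v)"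
    by (simp add: S_def scaleC_minus_one)
  have opS: "bounded_operator S"
    unfolding S_alt by (intro bounded_operator_combination bounded_operator_id opY)
  have SS: "S (S v) = B (B v)" for v
  proof -
    have "sqrt_limit C v + sqrt_limit C v = C v + sqrt_limit C (sqrt_limit C v)"
      using sqrt_limit_eq[OF lin bound, of v]
      by (metis scaleR_2 scaleR_scaleR scaleR_one nonzero_eq_divide_eq zero_neq_numeral mult.commute)
    moreover have "S (S v) = v - (sqrt_limit C v + sqrt_limit C v) + sqrt_limit C (sqrt_limit C v)"
      by (simp add: S_def linear_diff[OF linY])
    moreover have "C v = v - B (B v)" by (simp add: C_def)
    ultimately show ?thesis by simp
  qed
  have SB: "S (B v) = B (S v)" for v
    by (simp add: S_def linear_diff[OF linB] commute[OF B])
  have S\<rho>: "S (\<rho> x v) = \<rho> x (S v)" for x v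
    using commute[OF representationD(1)[OF rep]] comm
      bounded_operator_imp_linear[OF representationD(1)[OF rep]]
    by (simp add: S_def linear_diff)
  have \<rho>0: "\<rho> x 0 = 0" for x
    using bounded_operator_imp_linear[OF representationD(1)[OF rep]] by (rule linear_0)
  have \<rho>diff: "\<rho> x (v - w) = \<rho> x v - \<rho> x w" for x v w
    using bounded_operator_imp_linear[OF representationD(1)[OF rep]] by (rule linear_diff)
  \<comment> \<open>Expanding the squared norm of \<open>v - sqrt_limit C v\<close> and using that
    the limit map is a contraction bounds the real part of its form at \<open>v\<close> by the
    squared norm of \<open>v\<close>.\<close>
  have S_pos: "0 \<le> Re (cinner v (S v))" for v
  proof -
    have "Re (cinner v (S v)) = (norm v)\<^sup>2 - Re (cinner v (sqrt_limit C v))"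
      by (simp add: S_def cinner_diff_right cinner_self)
    then show ?thesis
      using norm_diff_square[of v "sqrt_limit C v"] zero_le_power2[of "norm (v - sqrt_limit C v)"]
        power_mono[OF norm_sqrt_limit[OF lin bound] norm_ge_zero, of v 2]
      by linarith
  qed
  have D_alt: "(\<lambda>v. S v - B v) = (\<lambda>v. 1 *\<^sub>C S v + (- 1) *\<^sub>C B v)"
    by (simp add: scaleC_minus_one)
  have "bounded_operator (\<lambda>v. S v - B v)"
    unfolding D_alt using opS B by (rule bounded_operator_combination)
  from kernel_invariant_subspace[OF irr this, simplified] S\<rho> comm \<rho>0 \<rho>diff
  consider "{v. S v - B v = 0} = {0}" | "\<forall>v. S v - B v = 0"
    by auto
  then show ?thesis
  proof cases
    case 1
    have "S (S v + B v) - B (S v + B v) = 0" for v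
      using SS SB opS B by (simp add: bounded_operator_add)
    then have "B v = - S v" for v
      using 1 by (auto simp: eq_neg_iff_add_eq_0 add.commute)
    then show ?thesis using S_pos by simp
  next
    case 2
    then show ?thesis using S_pos by simp
  qed
qed

text \<open>A minimum argument: if \<open>B u\<close> were nonzero, the form at
  \<open>u + t B u\<close> would be \<open>2 t a + t^2 c\<close> with \<open>a > 0\<close>, which is
  negative for small negative \<open>t\<close>.\<close>

lemma semidefinite_kernel:
  fixes B :: "'h::chilbert_space \<Rightarrow> 'h"
  assumes lin: "linear B" and sa: "\<And>v w. cinner (B v) w = cinner v (B w)"
    and pos: "\<And>v. 0 \<le> Re (cinner v (B v))" and zero: "Re (cinner u (B u)) = 0"
  shows "B u = 0"
proof (rule ccontr)
  assume "B u \<noteq> 0"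
  define a c where "a = (norm (B u))\<^sup>2" and "c = Re (cinner (B u) (B (B u)))"
  have a: "0 < a" using \<open>B u \<noteq> 0\<close> by (simp add: a_def)
  have "0 \<le> 2 * t * a + t\<^sup>2 * c" for t
  proof -
    have "cinner u (B (B u)) = a" "cinner (B u) (B u) = a"
      unfolding a_def using sa[of u "B u"] by (simp_all add: cinner_self)
    then have "Re (cinner (u + t *\<^sub>R B u) (B (u + t *\<^sub>R B u))) = 2 * t * a + t\<^sup>2 * c"
      using zero by (simp add: linear_add[OF lin] linear_scale[OF lin] cinner_add_left cinner_add_right
          cinner_scaleR_left cinner_scaleR_right c_def power2_eq_square algebra_simps)
    then show ?thesis using pos[of "u + t *\<^sub>R B u"] by simp
  qed
  \<comment> \<open>At this \<open>t\<close> the form is a positive multiple of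
    \<open>c / (|c| + 1) - 2\<close>, which is negative for either sign of \<open>c\<close>.\<close>
  from this[of "- (a / (\<bar>c\<bar> + 1))"]
  have "0 \<le> (a\<^sup>2 / (\<bar>c\<bar> + 1)) * (c / (\<bar>c\<bar> + 1) - 2)"
    by (simp add: power2_eq_square algebra_simps)
  moreover have "c / (\<bar>c\<bar> + 1) < 2" by (simp add: divide_less_eq) arith
  then have "(a\<^sup>2 / (\<bar>c\<bar> + 1)) * (c / (\<bar>c\<bar> + 1) - 2) < 0"
    using a by (intro mult_pos_neg divide_pos_pos) auto
  ultimately show False by linarith
qed

text \<open>Subtracting the mean value of \<open>A\<close> at a nonzero vector \<open>u\<close>
  gives a semidefinite operator whose form vanishes at \<open>u\<close>. It then annihilates
  \<open>u\<close>, so its kernel is nontrivial and must be the whole space.\<close>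

lemma schur_selfadjoint:
  fixes \<rho> :: "'a::cstar_algebra \<Rightarrow> 'h::chilbert_space \<Rightarrow> 'h"
  assumes irr: "irreducible_rep \<rho>" and rep: "representation \<rho>"
    and A: "bounded_operator A"
    and sa: "\<And>v w. cinner (A v) w = cinner v (A w)"
    and comm: "\<And>x v. A (\<rho> x v) = \<rho> x (A v)"
  obtains c where "\<And>v. A v = c *\<^sub>C v"
proof (cases "\<exists>u::'h. u \<noteq> 0")
  case False
  then show thesis using that by metis
next
  case True
  then obtain u :: 'h where u: "u \<noteq> 0" by blast
  define l where "l = Re (cinner u (A u)) / (norm u)\<^sup>2"
  obtain K where K: "\<And>v. norm (A v) \<le> K * norm v"
    using A by (auto simp: bounded_operator_def)
  have K0: "0 \<le> K"
    using order_trans[OF norm_ge_zero K[of u]] u by (simp add: zero_le_mult_iff)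
  \<comment> \<open>\<open>K + |l|\<close> bounds the norm of \<open>A - l\<close>, and the summand
    1 makes the divisor positive; scaling by \<open>r\<close> produces a contraction.\<close>
  define r where "r = 1 / (K + \<bar>l\<bar> + 1)"
  have r: "0 < r" using K0 by (simp add: r_def)
  define B where "B = (\<lambda>v. complex_of_real r *\<^sub>C A v + complex_of_real (- r * l) *\<^sub>C v)"
  have opB: "bounded_operator B"
    unfolding B_def by (intro bounded_operator_combination A bounded_operator_id)
  have B_eq: "B v = r *\<^sub>R (A v - l *\<^sub>R v)" for v
    unfolding B_def scaleC_of_real by (simp add: algebra_simps)
  have "norm (B v) \<le> norm v" for v
  proof -
    have "norm (A v - l *\<^sub>R v) \<le> (K + \<bar>l\<bar> + 1) * norm v"
      using K[of v] norm_triangle_ineq4[of "A v" "l *\<^sub>R v"] norm_ge_zero[of v]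
      unfolding distrib_right norm_scaleR by linarith
    then have "norm (B v) \<le> r * ((K + \<bar>l\<bar> + 1) * norm v)"
      using r by (simp add: B_eq)
    then show ?thesis using K0 by (simp add: r_def)
  qed
  moreover have saB: "cinner (B v) w = cinner v (B w)" for v w
    by (simp add: B_eq cinner_scaleR_left cinner_scaleR_right cinner_diff_left cinner_diff_right sa)
  moreover have commB: "B (\<rho> x v) = \<rho> x (B v)" for x v
    using comm bounded_operator_imp_linear[OF representationD(1)[OF rep]]
    by (simp add: B_eq linear_diff linear_scale)
  ultimately have sign: "(\<forall>v. 0 \<le> Re (cinner v (B v))) \<or> (\<forall>v. Re (cinner v (B v)) \<le> 0)"
    by (intro schur_semidefinite[OF irr rep opB])
  have zero: "Re (cinner u (B u)) = 0"
    using u by (simp add: B_eq cinner_scaleR_right cinner_diff_right cinner_self l_def)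
  note linB = bounded_operator_imp_linear[OF opB]
  have "B u = 0"
    using sign
  proof
    assume "\<forall>v. 0 \<le> Re (cinner v (B v))"
    then show ?thesis using semidefinite_kernel[OF linB saB _ zero] by blast
  next
    assume "\<forall>v. Re (cinner v (B v)) \<le> 0"
    then have "- B u = 0"
      using zero saB by (intro semidefinite_kernel[of "\<lambda>v. - B v"]) (auto intro: linear_compose_neg linB)
    then show ?thesis by simp
  qed
  moreover have "\<rho> x 0 = 0" for x
    using bounded_operator_imp_linear[OF representationD(1)[OF rep]] by (rule linear_0)
  ultimately have "\<forall>v. B v = 0"
    using kernel_invariant_subspace[OF irr opB commB] u by blast
  then have "A v = complex_of_real l *\<^sub>C v" for v
    using r by (simp add: B_eq scaleC_of_real)
  then show thesis by (rule that)
qed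

text \<open>The sum of \<open>T\<close> and its adjoint, and \<open>\<i>\<close> times their
  difference, are self-adjoint elements of the commutant. Both are scalars, and \<open>T\<close> is
  a linear combination of them.\<close>

lemma schur_unitary:
  fixes \<rho> :: "'a::cstar_algebra \<Rightarrow> 'h::chilbert_space \<Rightarrow> 'h"
  assumes irr: "irreducible_rep \<rho>" and rep: "representation \<rho>"
    and T: "unitary_operator T" and comm: "\<And>x. Ad T (\<rho> x) = \<rho> x"
  obtains c where "\<And>v. T v = c *\<^sub>C v"
proof -
  have comm1: "T (\<rho> x v) = \<rho> x (T v)" for x v
    using comm[of x] T by (metis Ad_def comp_apply hadj_left)
  have comm2: "hadj T (\<rho> x v) = \<rho> x (hadj T v)" for x v
    using comm1[of x "hadj T v"] T by (metis hadj_left hadj_right)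
  note ops = unitary_operatorD(1)[OF T] unitary_operatorD(1)[OF unitary_hadj[OF T]]
  note adj = cinner_hadj[OF T] cinner_hadj[OF unitary_hadj[OF T], unfolded hadj_hadj[OF T]]
  note \<rho>lin = representationD(1)[OF rep]
  obtain a where a: "\<And>v. 1 *\<^sub>C T v + 1 *\<^sub>C hadj T v = a *\<^sub>C v"
  proof (rule schur_selfadjoint[OF irr rep])
    show "bounded_operator (\<lambda>v. 1 *\<^sub>C T v + 1 *\<^sub>C hadj T v)"
      using ops by (rule bounded_operator_combination)
  qed (auto simp: cinner_add_left cinner_add_right adj comm1 comm2 bounded_operator_add[OF \<rho>lin])
  obtain b where b: "\<And>v. \<i> *\<^sub>C T v + (- \<i>) *\<^sub>C hadj T v = b *\<^sub>C v"
  proof (rule schur_selfadjoint[OF irr rep])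
    show "bounded_operator (\<lambda>v. \<i> *\<^sub>C T v + (- \<i>) *\<^sub>C hadj T v)"
      using ops by (rule bounded_operator_combination)
  qed (auto simp: cinner_add_left cinner_add_right cinner_scaleC_left cinner_scaleC_right adj comm1 comm2
      bounded_operator_add[OF \<rho>lin] bounded_operator_scaleC[OF \<rho>lin])
  have "T v = ((a - \<i> * b) / 2) *\<^sub>C v" for v
  proof -
    \<comment> \<open>Multiplying \<open>b\<close> by \<open>- \<i>\<close> recovers the difference
      of \<open>T\<close> and its adjoint, so the adjoint cancels against the one in
      \<open>a\<close>.\<close>
    have "((a - \<i> * b) / 2) *\<^sub>C v = (1/2) *\<^sub>C a *\<^sub>C v + (- \<i> / 2) *\<^sub>C b *\<^sub>C v"
      by (simp add: scaleC_scaleC diff_divide_distrib flip: scaleC_add_left)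
    also have "\<dots> = (1/2 + 1/2) *\<^sub>C T v + (1/2 - 1/2) *\<^sub>C hadj T v"
      unfolding a[symmetric] b[symmetric]
      by (simp add: scaleC_add_right scaleC_scaleC) (simp add: algebra_simps flip: scaleC_add_left)
    finally show ?thesis by simp
  qed
  then show thesis by (rule that)
qed

section \<open>Group cohomology in degree two\<close>

text \<open>Multiplication in \<open>AutoGroup\<close> is composition restricted to the carrier, so
  the action law is obtained for elements of the carrier.\<close>

lemma G_moduleD:
  assumes "G_module G M act"
  shows "comm_group M"
    and "g \<in> carrier G \<Longrightarrow> act g \<in> hom M M"
    and "g \<in> carrier G \<Longrightarrow> h \<in> carrier G \<Longrightarrow> x \<in> carrier M \<Longrightarrow>
      act (g \<otimes>\<^bsub>G\<^esub> h) x = act g (act h x)"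
proof -
  have act: "act \<in> hom G (AutoGroup M)" using assms by (simp add: G_module_def)
  show "comm_group M" using assms by (simp add: G_module_def)
  have auto: "act g \<in> auto M" if "g \<in> carrier G" for g
    using hom_in_carrier[OF act that] by (simp add: AutoGroup_def)
  then show "g \<in> carrier G \<Longrightarrow> act g \<in> hom M M" by (simp add: auto_def)
  show "g \<in> carrier G \<Longrightarrow> h \<in> carrier G \<Longrightarrow> x \<in> carrier M \<Longrightarrow>
      act (g \<otimes>\<^bsub>G\<^esub> h) x = act g (act h x)"
    using hom_mult[OF act, of g h] auto[of g] auto[of h]
    by (simp add: AutoGroup_def BijGroup_def auto_def compose_def)
qed

lemma group_cochains2: "group M \<Longrightarrow> group (cochains2 G M)"
  by (simp add: cochains2_def)

lemma cochains2_iff: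
  "c \<in> carrier (cochains2 G M) \<longleftrightarrow>
    c \<in> extensional (carrier G \<times> carrier G) \<and> (\<forall>g\<in>carrier G. \<forall>h\<in>carrier G. c (g, h) \<in> carrier M)"
  by (auto simp: cochains2_def PiE_def)

lemma cochains2_mult:
  "g \<in> carrier G \<Longrightarrow> h \<in> carrier G \<Longrightarrow> (c \<otimes>\<^bsub>cochains2 G M\<^esub> d) (g, h) = c (g, h) \<otimes>\<^bsub>M\<^esub> d (g, h)"
  by (simp add: cochains2_def)

lemma cochains2_inv:
  assumes "group M" "c \<in> carrier (cochains2 G M)" "g \<in> carrier G" "h \<in> carrier G"
  shows "(inv\<^bsub>cochains2 G M\<^esub> c) (g, h) = inv\<^bsub>M\<^esub> (c (g, h))"
  using assms unfolding cochains2_def by (subst inv_product_group) auto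

lemma subgroup_cocycles2:
  assumes "group G" "G_module G M act"
  shows "subgroup (cocycles2 G M act) (cochains2 G M)"
proof -
  interpret G: group G by fact
  interpret M: comm_group M using assms(2) by (rule G_moduleD)
  interpret C: group "cochains2 G M" by (simp add: group_cochains2 M.is_group)
  note act = G_moduleD(2)[OF assms(2)]
  note [simp] = cochains2_mult cochains2_iff[THEN iffD1, THEN conjunct2, rule_format] hom_mult[OF act]
    hom_in_carrier[OF act]
  show ?thesis
  proof (rule C.subgroupI)
    have "act g \<one>\<^bsub>M\<^esub> = \<one>\<^bsub>M\<^esub>" if "g \<in> carrier G" for g
      using act[OF that] by (rule hom_one) (rule M.is_group)+
    then have "\<one>\<^bsub>cochains2 G M\<^esub> \<in> cocycles2 G M act"
      unfolding cocycles2_def using C.one_closed by (simp add: cochains2_def)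
    then show "cocycles2 G M act \<noteq> {}" by blast
  next
    fix c assume c: "c \<in> cocycles2 G M act"
    then have cc: "c \<in> carrier (cochains2 G M)" by (simp add: cocycles2_def)
    note inv = cochains2_inv[OF M.is_group cc]
    have hominv: "act g (inv\<^bsub>M\<^esub> x) = inv\<^bsub>M\<^esub> (act g x)" if "g \<in> carrier G" "x \<in> carrier M" for g x
      using group_hom.hom_inv[of M M "act g" x] act that M.is_group
      by (simp add: group_hom_def group_hom_axioms_def)
    show "inv\<^bsub>cochains2 G M\<^esub> c \<in> cocycles2 G M act"
      using c cc by (simp add: cocycles2_def inv hominv flip: M.inv_mult)
  next
    fix c d assume "c \<in> cocycles2 G M act" "d \<in> cocycles2 G M act"
    then have c: "c \<in> carrier (cochains2 G M)" and d: "d \<in> carrier (cochains2 G M)"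
      and eqc: "\<And>g h k. g \<in> carrier G \<Longrightarrow> h \<in> carrier G \<Longrightarrow> k \<in> carrier G \<Longrightarrow>
        act g (c (h, k)) \<otimes>\<^bsub>M\<^esub> c (g, h \<otimes>\<^bsub>G\<^esub> k) = c (g \<otimes>\<^bsub>G\<^esub> h, k) \<otimes>\<^bsub>M\<^esub> c (g, h)"
      and eqd: "\<And>g h k. g \<in> carrier G \<Longrightarrow> h \<in> carrier G \<Longrightarrow> k \<in> carrier G \<Longrightarrow>
        act g (d (h, k)) \<otimes>\<^bsub>M\<^esub> d (g, h \<otimes>\<^bsub>G\<^esub> k) = d (g \<otimes>\<^bsub>G\<^esub> h, k) \<otimes>\<^bsub>M\<^esub> d (g, h)"
      by (auto simp: cocycles2_def)
    \<comment> \<open>Middle-four interchange separates the factors of \<open>c\<close> from those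
      of \<open>d\<close>, so that the two cocycle identities can be multiplied.\<close>
    have interchange: "(x \<otimes>\<^bsub>M\<^esub> y) \<otimes>\<^bsub>M\<^esub> (z \<otimes>\<^bsub>M\<^esub> w) = (x \<otimes>\<^bsub>M\<^esub> z) \<otimes>\<^bsub>M\<^esub> (y \<otimes>\<^bsub>M\<^esub> w)"
      if "x \<in> carrier M" "y \<in> carrier M" "z \<in> carrier M" "w \<in> carrier M" for x y z w
      using that by (simp add: M.m_ac)
    have "act g (c (h, k)) \<otimes>\<^bsub>M\<^esub> act g (d (h, k)) \<otimes>\<^bsub>M\<^esub> (c (g, h \<otimes>\<^bsub>G\<^esub> k) \<otimes>\<^bsub>M\<^esub> d (g, h \<otimes>\<^bsub>G\<^esub> k)) =
        c (g \<otimes>\<^bsub>G\<^esub> h, k) \<otimes>\<^bsub>M\<^esub> d (g \<otimes>\<^bsub>G\<^esub> h, k) \<otimes>\<^bsub>M\<^esub> (c (g, h) \<otimes>\<^bsub>M\<^esub> d (g, h))"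
      if "g \<in> carrier G" "h \<in> carrier G" "k \<in> carrier G" for g h k
      using that c d
      by (subst (1 2) interchange) (simp_all add: eqc eqd)
    then show "c \<otimes>\<^bsub>cochains2 G M\<^esub> d \<in> cocycles2 G M act"
      using c d C.m_closed[OF c d] unfolding cocycles2_def by simp
  qed (simp add: cocycles2_def)
qed

lemma group_cocycle_group2:
  assumes "group G" "G_module G M act"
  shows "group (cocycle_group2 G M act)"
  unfolding cocycle_group2_def
  using subgroup.subgroup_is_group[OF subgroup_cocycles2[OF assms] group_cochains2]
    G_moduleD(1)[OF assms(2)] by (simp add: comm_group_def)

lemma coboundary1_mem_cocycles2:
  assumes "group G" "G_module G M act" and b: "b \<in> carrier (cochains1 G M)"
  shows "coboundary1 G M act b \<in> cocycles2 G M act"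
proof -
  interpret G: group G by fact
  interpret M: comm_group M using assms(2) by (rule G_moduleD)
  note act = G_moduleD(2)[OF assms(2)]
  have b: "b g \<in> carrier M" if "g \<in> carrier G" for g
    using b that by (auto simp: cochains1_def)
  note [simp] = hom_mult[OF act] hom_in_carrier[OF act] b
  have hominv: "act g (inv\<^bsub>M\<^esub> x) = inv\<^bsub>M\<^esub> (act g x)" if "g \<in> carrier G" "x \<in> carrier M" for g x
    using group_hom.hom_inv[of M M "act g" x] act that M.is_group
    by (simp add: group_hom_def group_hom_axioms_def)
  \<comment> \<open>To be read with \<open>x\<close>, \<open>y\<close>, \<open>z\<close> as the
    translates \<open>g h b(k)\<close>, \<open>g b(hk)\<close>, \<open>g b(h)\<close>, with
    \<open>u\<close> as the inverse of \<open>b(ghk)\<close>, and with \<open>w\<close>,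
    \<open>t\<close> as \<open>b(g)\<close>, \<open>b(gh)\<close>: \<open>y\<close> cancels on the
    left and \<open>t\<close> on the right.\<close>
  have cancel: "(x \<otimes>\<^bsub>M\<^esub> inv\<^bsub>M\<^esub> y \<otimes>\<^bsub>M\<^esub> z) \<otimes>\<^bsub>M\<^esub> (y \<otimes>\<^bsub>M\<^esub> u \<otimes>\<^bsub>M\<^esub> w) =
      (x \<otimes>\<^bsub>M\<^esub> u \<otimes>\<^bsub>M\<^esub> t) \<otimes>\<^bsub>M\<^esub> (z \<otimes>\<^bsub>M\<^esub> inv\<^bsub>M\<^esub> t \<otimes>\<^bsub>M\<^esub> w)"
    if "x \<in> carrier M" "y \<in> carrier M" "z \<in> carrier M" "u \<in> carrier M" "w \<in> carrier M" "t \<in> carrier M"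
    for x y z u w t
  proof -
    have "(x \<otimes>\<^bsub>M\<^esub> inv\<^bsub>M\<^esub> y \<otimes>\<^bsub>M\<^esub> z) \<otimes>\<^bsub>M\<^esub> (y \<otimes>\<^bsub>M\<^esub> u \<otimes>\<^bsub>M\<^esub> w) =
        (inv\<^bsub>M\<^esub> y \<otimes>\<^bsub>M\<^esub> y) \<otimes>\<^bsub>M\<^esub> (x \<otimes>\<^bsub>M\<^esub> z \<otimes>\<^bsub>M\<^esub> u \<otimes>\<^bsub>M\<^esub> w)"
      using that by (simp only: M.m_ac M.m_closed M.inv_closed)
    also have "\<dots> = (inv\<^bsub>M\<^esub> t \<otimes>\<^bsub>M\<^esub> t) \<otimes>\<^bsub>M\<^esub> (x \<otimes>\<^bsub>M\<^esub> z \<otimes>\<^bsub>M\<^esub> u \<otimes>\<^bsub>M\<^esub> w)"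
      using that by (simp add: M.l_inv)
    also have "\<dots> = (x \<otimes>\<^bsub>M\<^esub> u \<otimes>\<^bsub>M\<^esub> t) \<otimes>\<^bsub>M\<^esub> (z \<otimes>\<^bsub>M\<^esub> inv\<^bsub>M\<^esub> t \<otimes>\<^bsub>M\<^esub> w)"
      using that by (simp only: M.m_ac M.m_closed M.inv_closed)
    finally show ?thesis .
  qed
  show ?thesis
    unfolding cocycles2_def
    by (simp add: cochains2_iff coboundary1_def hominv cancel G_moduleD(3)[OF assms(2)] G.m_assoc)
qed

text \<open>Being the image of a homomorphism makes the coboundaries a subgroup.\<close>

lemma coboundary1_hom:
  assumes "group G" "G_module G M act"
  shows "coboundary1 G M act \<in> hom (cochains1 G M) (cochains2 G M)"
proof (rule homI)
  interpret G: group G by fact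
  interpret M: comm_group M using assms(2) by (rule G_moduleD)
  note act = G_moduleD(2)[OF assms(2)]
  show "coboundary1 G M act b \<in> carrier (cochains2 G M)" if "b \<in> carrier (cochains1 G M)" for b
    using coboundary1_mem_cocycles2[OF assms that] by (simp add: cocycles2_def)
  fix b d assume "b \<in> carrier (cochains1 G M)" "d \<in> carrier (cochains1 G M)"
  then have [simp]: "b g \<in> carrier M" "d g \<in> carrier M" if "g \<in> carrier G" for g
    using that by (auto simp: cochains1_def)
  note [simp] = hom_mult[OF act] hom_in_carrier[OF act]
  show "coboundary1 G M act (b \<otimes>\<^bsub>cochains1 G M\<^esub> d) =
      coboundary1 G M act b \<otimes>\<^bsub>cochains2 G M\<^esub> coboundary1 G M act d"
    by (auto simp: coboundary1_def cochains1_def cochains2_def fun_eq_iff M.inv_mult M.m_ac)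
qed

lemma subgroup_coboundaries2:
  assumes "group G" "G_module G M act"
  shows "subgroup (coboundaries2 G M act) (cocycle_group2 G M act)"
proof -
  interpret M: comm_group M using assms(2) by (rule G_moduleD)
  interpret C: group "cochains2 G M" by (simp add: group_cochains2 M.is_group)
  have "group_hom (cochains1 G M) (cochains2 G M) (coboundary1 G M act)"
    using coboundary1_hom[OF assms] C.is_group M.is_group
    by (simp add: group_hom_def group_hom_axioms_def cochains1_def)
  then have "subgroup (coboundaries2 G M act) (cochains2 G M)"
    unfolding coboundaries2_def by (rule group_hom.img_is_subgroup)
  moreover have "coboundaries2 G M act \<subseteq> cocycles2 G M act"
    using coboundary1_mem_cocycles2[OF assms] by (auto simp: coboundaries2_def)
  ultimately show ?thesis
    unfolding cocycle_group2_def using subgroup_cocycles2[OF assms] by (intro C.subgroup_incl)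
qed

lemma cohomology_class2_mem:
  assumes "c \<in> cocycles2 G M act"
  shows "cohomology_class2 G M act c \<in> carrier (cohomology2 G M act)"
  using assms
  by (auto simp: cohomology_class2_def cohomology2_def carrier_FactGroup cocycle_group2_def)

text \<open>Classes are right cosets of the coboundaries, and \<open>d\<close> lies in the coset of
  \<open>c\<close>.\<close>

lemma cohomology_class2_eqI:
  assumes "group G" "G_module G M act" "c \<in> cocycles2 G M act" "b \<in> carrier (cochains1 G M)"
    and d: "d = coboundary1 G M act b \<otimes>\<^bsub>cochains2 G M\<^esub> c"
  shows "cohomology_class2 G M act c = cohomology_class2 G M act d"
  unfolding cohomology_class2_def
proof (rule group.repr_independence)
  show "group (cocycle_group2 G M act)" using assms(1,2) by (rule group_cocycle_group2)
  show "subgroup (coboundaries2 G M act) (cocycle_group2 G M act)"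
    using assms(1,2) by (rule subgroup_coboundaries2)
  show "c \<in> carrier (cocycle_group2 G M act)" using assms(3) by (simp add: cocycle_group2_def)
  show "d \<in> coboundaries2 G M act #>\<^bsub>cocycle_group2 G M act\<^esub> c"
    using assms(4) by (auto simp: d r_coset_def coboundaries2_def cocycle_group2_def)
qed

section \<open>The module of unimodular functions on the sectors\<close>

lemma comm_group_U1: "comm_group U1"
proof (rule comm_groupI)
  show "\<exists>y\<in>carrier U1. y \<otimes>\<^bsub>U1\<^esub> x = \<one>\<^bsub>U1\<^esub>" if "x \<in> carrier U1" for x
    using that by (intro bexI[of _ "inverse x"]) (auto simp: U1_def norm_inverse norm_divide field_simps)
qed (auto simp: U1_def norm_mult)

lemma inv_U1: "z \<in> carrier U1 \<Longrightarrow> inv\<^bsub>U1\<^esub> z = inverse z"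
  using comm_group_U1
  by (intro group.inv_equality) (auto simp: comm_group_def U1_def norm_inverse norm_divide field_simps)

lemma sector_module_simps:
  "x \<in> carrier (sector_module S) \<longleftrightarrow> x \<in> extensional S \<and> (\<forall>a\<in>S. cmod (x a) = 1)"
  "x \<otimes>\<^bsub>sector_module S\<^esub> y = (\<lambda>a\<in>S. x a * y a)"
  by (auto simp: sector_module_def PiE_def U1_def)

lemma comm_group_sector_module: "comm_group (sector_module S)"
proof -
  have "group (sector_module S)"
    using comm_group_U1 by (simp add: sector_module_def comm_group_def)
  then show ?thesis
    by (rule group.group_comm_groupI) (simp add: sector_module_simps mult.commute)
qed

lemma inv_sector_module:
  assumes "x \<in> carrier (sector_module S)"
  shows "inv\<^bsub>sector_module S\<^esub> x = (\<lambda>a\<in>S. inverse (x a))"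
proof -
  have "inv\<^bsub>sector_module S\<^esub> x = (\<lambda>a\<in>S. inv\<^bsub>U1\<^esub> (x a))"
    unfolding sector_module_def using assms comm_group_U1
    by (intro inv_product_group) (auto simp: sector_module_def comm_group_def)
  also have "\<dots> = (\<lambda>a\<in>S. inverse (x a))"
    using assms by (intro restrict_ext inv_U1) (auto simp: sector_module_def)
  finally show ?thesis .
qed

text \<open>A left action of \<open>G\<close>, with its laws imposed on \<open>S\<close> because
  \<open>mv\<close> is uncontrolled elsewhere.\<close>

locale sector_permutation = group G for G (structure) +
  fixes S :: "'s set" and mv :: "'a \<Rightarrow> 's \<Rightarrow> 's"
  assumes mv_closed: "g \<in> carrier G \<Longrightarrow> a \<in> S \<Longrightarrow> mv g a \<in> S"
    and mv_mult: "g \<in> carrier G \<Longrightarrow> h \<in> carrier G \<Longrightarrow> a \<in> S \<Longrightarrow> mv g (mv h a) = mv (g \<otimes> h) a"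
    and mv_one: "a \<in> S \<Longrightarrow> mv \<one> a = a"
begin

lemma sector_action_closed:
  "g \<in> carrier G \<Longrightarrow> x \<in> carrier (sector_module S) \<Longrightarrow>
    sector_action G S mv g x \<in> carrier (sector_module S)"
  by (simp add: sector_action_def sector_module_simps(1) mv_closed)

lemma sector_action_apply:
  "x \<in> carrier (sector_module S) \<Longrightarrow> a \<in> S \<Longrightarrow> sector_action G S mv g x a = x (mv (inv g) a)"
  by (simp add: sector_action_def)

text \<open>Precomposition reverses products and so does inversion; together they yield a left
  action.\<close>

lemma sector_action_mult:
  assumes "g \<in> carrier G" "h \<in> carrier G" "x \<in> carrier (sector_module S)"
  shows "sector_action G S mv (g \<otimes> h) x = sector_action G S mv g (sector_action G S mv h x)"
proof (rule extensionalityI[of _ S])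
  show "sector_action G S mv (g \<otimes> h) x \<in> extensional S"
    "sector_action G S mv g (sector_action G S mv h x) \<in> extensional S"
    using assms sector_action_closed by (auto simp: sector_module_simps(1))
  show "sector_action G S mv (g \<otimes> h) x a = sector_action G S mv g (sector_action G S mv h x) a"
    if "a \<in> S" for a
    using assms that by (simp add: sector_action_apply sector_action_closed mv_closed mv_mult inv_mult_group)
qed

lemma sector_action_one:
  assumes "x \<in> carrier (sector_module S)"
  shows "sector_action G S mv \<one> x = x"
proof (rule extensionalityI[of _ S])
  show "sector_action G S mv \<one> x \<in> extensional S" "x \<in> extensional S"
    using assms sector_action_closed[of \<one> x] by (auto simp: sector_module_simps(1))
  show "sector_action G S mv \<one> x a = x a" if "a \<in> S" for a
    using assms that by (simp add: sector_action_apply mv_one)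
qed

lemma sector_action_auto:
  assumes g: "g \<in> carrier G"
  shows "sector_action G S mv g \<in> auto (sector_module S)"
proof -
  let ?M = "sector_module S" and ?act = "sector_action G S mv"
  have inv: "?act g (?act (inv g) x) = x" "?act (inv g) (?act g x) = x" if "x \<in> carrier ?M" for x
    using g that by (simp_all add: sector_action_one flip: sector_action_mult)
  have "bij_betw (?act g) (carrier ?M) (carrier ?M)"
    by (rule bij_betwI[of _ _ _ "?act (inv g)"]) (use g in \<open>auto simp: inv sector_action_closed\<close>)
  moreover have "?act g \<in> hom ?M ?M"
  proof (rule homI)
    fix x y assume xy: "x \<in> carrier ?M" "y \<in> carrier ?M"
    interpret M: comm_group ?M by (rule comm_group_sector_module)
    show "?act g (x \<otimes>\<^bsub>?M\<^esub> y) = ?act g x \<otimes>\<^bsub>?M\<^esub> ?act g y"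
    proof (rule extensionalityI[of _ S])
      show "?act g (x \<otimes>\<^bsub>?M\<^esub> y) \<in> extensional S" "?act g x \<otimes>\<^bsub>?M\<^esub> ?act g y \<in> extensional S"
        using g M.m_closed[OF xy] sector_action_closed
        by (auto simp: sector_module_simps)
      show "?act g (x \<otimes>\<^bsub>?M\<^esub> y) a = (?act g x \<otimes>\<^bsub>?M\<^esub> ?act g y) a" if "a \<in> S" for a
        using that xy g M.m_closed[OF xy]
        by (simp add: sector_action_apply) (simp add: sector_module_simps(2) mv_closed sector_action_apply xy)
    qed
  qed (rule sector_action_closed[OF g])
  ultimately show ?thesis
    by (simp add: auto_def Bij_def sector_action_def)
qed

lemma G_module_sector_module: "G_module G (sector_module S) (sector_action G S mv)"
  unfolding G_module_def
proof (intro conjI homI)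
  show "comm_group (sector_module S)" by (rule comm_group_sector_module)
  show "sector_action G S mv g \<in> carrier (AutoGroup (sector_module S))" if "g \<in> carrier G" for g
    using sector_action_auto[OF that] by (simp add: AutoGroup_def)
  fix g h assume gh: "g \<in> carrier G" "h \<in> carrier G"
  have "sector_action G S mv (g \<otimes> h) =
      compose (carrier (sector_module S)) (sector_action G S mv g) (sector_action G S mv h)"
  proof (rule extensionalityI[of _ "carrier (sector_module S)"])
    show "sector_action G S mv (g \<otimes> h) \<in> extensional (carrier (sector_module S))"
      by (simp add: sector_action_def)
  qed (use gh in \<open>simp_all add: compose_def sector_action_mult\<close>)
  then show "sector_action G S mv (g \<otimes> h) =
      sector_action G S mv g \<otimes>\<^bsub>AutoGroup (sector_module S)\<^esub> sector_action G S mv h"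
    using sector_action_auto gh by (simp add: AutoGroup_def BijGroup_def auto_def)
qed

end

section \<open>The cocycle of a family of intertwiners\<close>

text \<open>What the cohomological argument takes from operator algebras. The group law of \<beta>
  is required under each \<open>rep a\<close>, and Schur's lemma enters as a hypothesis. A nonzero
  vector makes \<open>omega_scalar\<close> unique.\<close>

locale sector_system = sector_permutation G S mv
  for G :: "'g monoid" (structure) and S :: "'s set" and mv :: "'g \<Rightarrow> 's \<Rightarrow> 's" +
  fixes R :: "'g \<Rightarrow> 'h::chilbert_space \<Rightarrow> 'h" and \<beta> :: "'g \<Rightarrow> 'a::cstar_algebra \<Rightarrow> 'a"
    and rep :: "'s \<Rightarrow> 'a \<Rightarrow> 'h \<Rightarrow> 'h"
  assumes R: "unitary_operator_rep G R"
    and rep_\<beta>: "a \<in> S \<Longrightarrow> g \<in> carrier G \<Longrightarrow> h \<in> carrier G \<Longrightarrow>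
      rep a (\<beta> (inv h) (\<beta> (inv g) x)) = rep a (\<beta> (inv (g \<otimes> h)) x)"
    and schur: "a \<in> S \<Longrightarrow> unitary_operator T \<Longrightarrow> (\<And>x. Ad T (rep a x) = rep a x) \<Longrightarrow>
      \<exists>c. \<forall>v. T v = c *\<^sub>C v"
    and nontrivial: "\<exists>v::'h. v \<noteq> 0"
begin

abbreviation (input) "W_system \<equiv> intertwiners G R \<beta> S rep mv"
abbreviation (input) "M \<equiv> sector_module S"
abbreviation (input) "act \<equiv> sector_action G S mv"

lemma scalar_eqI: "(\<And>v::'h. c *\<^sub>C v = c' *\<^sub>C v) \<Longrightarrow> c = c'"
  using nontrivial scaleC_right_cancel by blast

lemma unitary_R: "g \<in> carrier G \<Longrightarrow> unitary_operator (R g)"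
  using R by (simp add: unitary_operator_rep_def)

lemma R_mult: "g \<in> carrier G \<Longrightarrow> h \<in> carrier G \<Longrightarrow> R (g \<otimes> h) v = R g (R h v)"
  using R by (simp add: unitary_operator_rep_def)

lemma intertwinersD:
  assumes "W_system W" "a \<in> S" "g \<in> carrier G"
  shows "unitary_operator (W a g)"
    and "Ad (R g) (rep a (\<beta> (inv g) x)) = Ad (W a g) (rep (mv g a) x)"
  using assms by (auto simp: intertwiners_def Theta_def)

text \<open>The quotient \<open>hadj V \<circ> V'\<close> commutes with \<open>rep a\<close>, hence
  is a scalar. Comparing norms at a nonzero vector shows that its modulus is 1.\<close>

lemma schur_ratio:
  assumes a: "a \<in> S" and V: "unitary_operator V" and V': "unitary_operator V'"
    and eq: "\<And>x. Ad V (rep a x) = Ad V' (rep a x)"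
  obtains c where "cmod c = 1" "\<And>v. V' v = c *\<^sub>C V v"
proof -
  have "Ad (hadj V \<circ> V') (rep a x) = rep a x" for x
    using V V' eq[of x, symmetric] by (simp add: Ad_comp unitary_hadj)
  then obtain c where c: "\<And>v. (hadj V \<circ> V') v = c *\<^sub>C v"
    using schur[OF a unitary_comp[OF unitary_hadj[OF V] V']] by blast
  have V'_eq: "V' v = c *\<^sub>C V v" for v
    using c[of v] V by (metis comp_apply hadj_right bounded_operator_scaleC unitary_operatorD(1))
  obtain u :: 'h where u: "u \<noteq> 0" using nontrivial by blast
  have "norm u = cmod c * norm u"
    using V'_eq[of u] unitary_norm[OF V] unitary_norm[OF V'] by (metis norm_scaleC)
  then have "cmod c = 1" using u by simp
  then show thesis using V'_eq by (rule that)
qed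

text \<open>The candidate for \<open>W a (g \<otimes> h)\<close> assembled from the separate
  symmetries: \<open>W a h\<close> transported by \<open>R g\<close>, times the intertwiner at the
  moved sector. \<open>omega_operator\<close> measures \<open>W a (g \<otimes> h)\<close> against
  it.\<close>

abbreviation "W_product W a g h \<equiv> R g \<circ> W a h \<circ> hadj (R g) \<circ> W (mv h a) g"

lemma unitary_W_product:
  assumes "W_system W" "a \<in> S" "g \<in> carrier G" "h \<in> carrier G"
  shows "unitary_operator (W_product W a g h)"
  using assms by (intro unitary_comp unitary_hadj unitary_R intertwinersD mv_closed)

text \<open>Working from the innermost factor outwards, the intertwining relations replace each
  \<open>W\<close> by an \<open>R\<close>. What remains is \<open>Theta\<close> of
  \<open>g \<otimes> h\<close> applied to \<open>rep a\<close>, which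
  \<open>W a (g \<otimes> h)\<close> implements as well.\<close>

lemma Ad_W_product:
  assumes W: "W_system W" and a: "a \<in> S" and g: "g \<in> carrier G" and h: "h \<in> carrier G"
  shows "Ad (W_product W a g h) (rep (mv (g \<otimes> h) a) x) = Ad (W a (g \<otimes> h)) (rep (mv (g \<otimes> h) a) x)"
proof -
  note Rg = unitary_R[OF g] and Rh = unitary_R[OF h]
  note Wh = intertwinersD[OF W a h] and Wg = intertwinersD[OF W mv_closed[OF h a] g]
  have "Ad (W_product W a g h) (rep (mv (g \<otimes> h) a) x) =
      Ad (R g) (Ad (W a h) (Ad (hadj (R g)) (Ad (W (mv h a) g) (rep (mv g (mv h a)) x))))"
    using Rg Wh(1) Wg(1) by (simp add: Ad_comp unitary_comp unitary_hadj mv_mult a g h)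
  also have "\<dots> = Ad (R g) (Ad (W a h) (rep (mv h a) (\<beta> (inv g) x)))"
    using Rg by (simp flip: Wg(2))
  also have "\<dots> = Ad (R g) (Ad (R h) (rep a (\<beta> (inv h) (\<beta> (inv g) x))))"
    by (simp flip: Wh(2))
  also have "\<dots> = Ad (R (g \<otimes> h)) (rep a (\<beta> (inv (g \<otimes> h)) x))"
    using R g h by (simp add: rep_\<beta> a unitary_operator_rep_def Ad_comp)
  also have "\<dots> = Ad (W a (g \<otimes> h)) (rep (mv (g \<otimes> h) a) x)"
    using a g h by (intro intertwinersD[OF W]) auto
  finally show ?thesis .
qed

lemma omega_operator_eq:
  assumes W: "W_system W" and a: "a \<in> S" and g: "g \<in> carrier G" and h: "h \<in> carrier G"
  shows "omega_operator G R mv W a g h = hadj (W_product W a g h) \<circ> W a (g \<otimes> h)"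
  using unitary_R[OF g] intertwinersD(1)[OF W a h] intertwinersD(1)[OF W mv_closed[OF h a] g]
  by (simp add: omega_operator_def hadj_comp unitary_comp unitary_hadj hadj_hadj comp_assoc)

text \<open>One relation yields both the operator identity and the value of the definite
  description. It serves to show that the scalar exists and to compute it after a change of
  intertwiners.\<close>

lemma omega_scalar_eqI:
  assumes W: "W_system W" and a: "a \<in> S" and g: "g \<in> carrier G" and h: "h \<in> carrier G"
    and eq: "\<And>v. W a (g \<otimes> h) v = c *\<^sub>C W_product W a g h v"
  shows "omega_operator G R mv W a g h = (\<lambda>v. c *\<^sub>C v)" "omega_scalar G R mv W a g h = c"
proof -
  note U = unitary_W_product[OF W a g h]
  show *: "omega_operator G R mv W a g h = (\<lambda>v. c *\<^sub>C v)"
    unfolding omega_operator_eq[OF W a g h] comp_def[of "hadj _"] eq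
    using bounded_operator_scaleC[OF unitary_operatorD(1)[OF unitary_hadj[OF U]]] hadj_left[OF U]
    by (simp add: comp_assoc)
  show "omega_scalar G R mv W a g h = c"
    unfolding omega_scalar_def * using scalar_eqI by (intro the_equality) (auto dest: fun_cong)
qed

lemma omega_scalar:
  assumes W: "W_system W" and a: "a \<in> S" and g: "g \<in> carrier G" and h: "h \<in> carrier G"
  shows "cmod (omega_scalar G R mv W a g h) = 1"
    and "W a (g \<otimes> h) v =
      omega_scalar G R mv W a g h *\<^sub>C R g (W a h (hadj (R g) (W (mv h a) g v)))"
    and "omega_operator G R mv W a g h = (\<lambda>v. omega_scalar G R mv W a g h *\<^sub>C v)"
proof -
  obtain c where c: "cmod c = 1" "\<And>v. W a (g \<otimes> h) v = c *\<^sub>C W_product W a g h v"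
    using schur_ratio[OF _ unitary_W_product[OF W a g h] intertwinersD(1)[OF W a] Ad_W_product[OF W a g h]]
      a g h mv_closed by blast
  note omega = omega_scalar_eqI[OF W a g h c(2)]
  show "cmod (omega_scalar G R mv W a g h) = 1"
    "W a (g \<otimes> h) v = omega_scalar G R mv W a g h *\<^sub>C R g (W a h (hadj (R g) (W (mv h a) g v)))"
    "omega_operator G R mv W a g h = (\<lambda>v. omega_scalar G R mv W a g h *\<^sub>C v)"
    using c(1) c(2)[of v] by (simp_all add: omega)
qed

lemma omega_scalar_cocycle:
  assumes W: "W_system W" and a: "a \<in> S"
    and g: "g \<in> carrier G" and h: "h \<in> carrier G" and k: "k \<in> carrier G"
  shows "omega_scalar G R mv W a h k * omega_scalar G R mv W a g (h \<otimes> k) =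
    omega_scalar G R mv W a (g \<otimes> h) k * omega_scalar G R mv W (mv k a) g h"
proof -
  let ?w = "omega_scalar G R mv W"
  note ka = mv_closed[OF k a] and hk = m_closed[OF h k] and gh = m_closed[OF g h]
  note Rg = unitary_R[OF g] and Rh = unitary_R[OF h] and Rgh = unitary_R[OF gh]
  note Wk = intertwinersD(1)[OF W a k]
  note lin = bounded_operator_scaleC[OF unitary_operatorD(1)]
  \<comment> \<open>The operator that remains when the scalars are pulled out of either bracketing
    of \<open>g\<close>, \<open>h\<close>, \<open>k\<close>.\<close>
  define F where "F = (\<lambda>v. R g (R h (W a k (hadj (R h) (W (mv k a) h (hadj (R g)
    (W (mv (h \<otimes> k) a) g v)))))))"
  \<comment> \<open>In the bracketing \<open>(g h) k\<close> the adjoint of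
    \<open>R (g \<otimes> h)\<close> meets \<open>R g\<close>; this cancellation leads back to
    \<open>F\<close>.\<close>
  have hadj_Rgh: "hadj (R (g \<otimes> h)) (R g v) = hadj (R h) v" for v
  proof -
    have "R (g \<otimes> h) (hadj (R h) v) = R g v"
      using Rh by (simp add: R_mult g h)
    then show ?thesis using Rgh by (metis hadj_left)
  qed
  have "(?w a g (h \<otimes> k) * ?w a h k) *\<^sub>C F v = (?w a (g \<otimes> h) k * ?w (mv k a) g h) *\<^sub>C F v" for v
  proof -
    have "(?w a g (h \<otimes> k) * ?w a h k) *\<^sub>C F v = W a (g \<otimes> (h \<otimes> k)) v"
      unfolding omega_scalar(2)[OF W a g hk] omega_scalar(2)[OF W a h k]
      by (simp add: F_def lin Rg scaleC_scaleC)
    also have "\<dots> = W a ((g \<otimes> h) \<otimes> k) v"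
      using g h k by (simp add: m_assoc)
    also have "\<dots> = (?w a (g \<otimes> h) k * ?w (mv k a) g h) *\<^sub>C F v"
      unfolding omega_scalar(2)[OF W a gh k] omega_scalar(2)[OF W ka g h]
      by (simp add: F_def lin Rgh Wk unitary_hadj scaleC_scaleC hadj_Rgh mv_mult R_mult a g h k)
    finally show ?thesis .
  qed
  \<comment> \<open>The scalars can be compared on all vectors once \<open>F\<close> is onto. The
    preimage applies the inverse factors in reverse order.\<close>
  moreover have "\<exists>v. F v = u" for u
    by (rule exI[of _ "hadj (W (mv (h \<otimes> k) a) g) (R g (hadj (W (mv k a) h) (R h (hadj (W a k)
        (hadj (R h) (hadj (R g) u))))))"])
      (simp add: F_def Rg Rh Wk intertwinersD(1)[OF W ka h]
        intertwinersD(1)[OF W mv_closed[OF hk a] g] hadj_hadj unitary_hadj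
        hadj_left[OF Rg] hadj_left[OF Rh])
  ultimately have "?w a g (h \<otimes> k) * ?w a h k = ?w a (g \<otimes> h) k * ?w (mv k a) g h"
    by (intro scalar_eqI) metis
  then show ?thesis by (simp add: mult.commute)
qed

section \<open>Cocycle identity and cohomology class of \<open>eta\<close>\<close>

lemma eta_apply:
  "g \<in> carrier G \<Longrightarrow> h \<in> carrier G \<Longrightarrow> a \<in> S \<Longrightarrow>
    eta G R S mv W (g, h) a = omega_scalar G R mv W (mv (inv (g \<otimes> h)) a) g h"
  by (simp add: eta_def)

lemma eta_mem_module:
  assumes "W_system W" "g \<in> carrier G" "h \<in> carrier G"
  shows "eta G R S mv W (g, h) \<in> carrier M"
  using assms by (simp add: sector_module_simps(1) eta_def omega_scalar(1) mv_closed)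

lemma eta_cocycle_identity:
  assumes W: "W_system W" and a: "a \<in> S"
    and g: "g \<in> carrier G" and h: "h \<in> carrier G" and k: "k \<in> carrier G"
  shows "eta G R S mv W (h, k) (mv (inv g) a) * eta G R S mv W (g, h \<otimes> k) a =
    eta G R S mv W (g \<otimes> h, k) a * eta G R S mv W (g, h) a"
proof -
  \<comment> \<open>With \<open>a\<close> moved back by the whole product, three of the four values
    of \<open>eta\<close> are scalars at \<open>b\<close>, and the value at \<open>(g, h)\<close> is
    the scalar at \<open>mv k b\<close>.\<close>
  define b where "b = mv (inv (g \<otimes> h \<otimes> k)) a"
  have "b \<in> S" using a g h k by (simp add: b_def mv_closed)
  moreover have "mv (inv (h \<otimes> k)) (mv (inv g) a) = b" "mv (inv (g \<otimes> (h \<otimes> k))) a = b"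
    "mv k b = mv (inv (g \<otimes> h)) a"
    using a g h k by (simp_all add: b_def mv_mult inv_mult_group m_assoc mv_closed)
      (simp add: m_assoc[symmetric])
  ultimately show ?thesis
    using omega_scalar_cocycle[OF W \<open>b \<in> S\<close> g h k] a g h k
    by (simp add: eta_apply mv_closed flip: b_def)
qed

lemma eta_mem_cocycles2:
  assumes W: "W_system W"
  shows "eta G R S mv W \<in> cocycles2 G M act"
proof -
  interpret M: comm_group M by (rule comm_group_sector_module)
  note mem = eta_mem_module[OF W]
  have "act g (eta G R S mv W (h, k)) \<otimes>\<^bsub>M\<^esub> eta G R S mv W (g, h \<otimes> k) =
      eta G R S mv W (g \<otimes> h, k) \<otimes>\<^bsub>M\<^esub> eta G R S mv W (g, h)"
    if "g \<in> carrier G" "h \<in> carrier G" "k \<in> carrier G" for g h k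
    unfolding sector_module_simps(2)
    by (rule restrict_ext) (simp add: that mem sector_action_apply eta_cocycle_identity[OF W])
  then show ?thesis
    using mem by (simp add: cocycles2_def cochains2_iff) (simp add: eta_def)
qed

lemma eta_cohomologous:
  assumes W: "W_system W" and W': "W_system W'"
  obtains b where "b \<in> carrier (cochains1 G M)"
    "eta G R S mv W' = coboundary1 G M act b \<otimes>\<^bsub>cochains2 G M\<^esub> eta G R S mv W"
proof -
  let ?w = "omega_scalar G R mv W" and ?w' = "omega_scalar G R mv W'"
  \<comment> \<open>Both families conjugate \<open>rep (mv g a)\<close> into
    \<open>Theta g (rep a)\<close>, so Schur's lemma is applied at the moved sector.\<close>
  have "\<exists>c. cmod c = 1 \<and> (\<forall>v. W' a g v = c *\<^sub>C W a g v)" if "a \<in> S" "g \<in> carrier G" for a g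
    using schur_ratio[OF mv_closed[OF that(2,1)] intertwinersD(1)[OF W that] intertwinersD(1)[OF W' that]]
      intertwinersD(2)[OF W that] intertwinersD(2)[OF W' that] by metis
  then obtain z where z: "\<And>a g. a \<in> S \<Longrightarrow> g \<in> carrier G \<Longrightarrow> cmod (z a g) = 1"
    "\<And>a g v. a \<in> S \<Longrightarrow> g \<in> carrier G \<Longrightarrow> W' a g v = z a g *\<^sub>C W a g v"
    by metis
  have z0: "z a g \<noteq> 0" if "a \<in> S" "g \<in> carrier G" for a g
    using z(1)[OF that] by auto
  have w': "?w' a g h = inverse (z a h) * z a (g \<otimes> h) * inverse (z (mv h a) g) * ?w a g h"
    if a: "a \<in> S" and g: "g \<in> carrier G" and h: "h \<in> carrier G" for a g h
  proof (rule omega_scalar_eqI(2)[OF W' a g h])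
    fix v
    note lin = bounded_operator_scaleC[OF unitary_operatorD(1)]
    have "W_product W' a g h v = (z a h * z (mv h a) g) *\<^sub>C W_product W a g h v"
      using unitary_R[OF g] intertwinersD(1)[OF W a h] a g h
      by (simp add: z(2) mv_closed lin unitary_hadj scaleC_scaleC mult.commute)
    moreover have "W' a (g \<otimes> h) v = (z a (g \<otimes> h) * ?w a g h) *\<^sub>C W_product W a g h v"
      using a g h by (simp add: z(2) omega_scalar(2)[OF W] scaleC_scaleC)
    ultimately show "W' a (g \<otimes> h) v = (inverse (z a h) * z a (g \<otimes> h) * inverse (z (mv h a) g) *
        ?w a g h) *\<^sub>C W_product W' a g h v"
      using z0[OF a h] z0[OF mv_closed[OF h a] g] by (simp add: scaleC_scaleC field_simps del: comp_apply)
  qed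
  \<comment> \<open>The phase is inverted because the adjoints of the two single intertwiners occur
    in \<open>omega_operator\<close>, and read at the sector moved back by \<open>g\<close> to match
    the index of \<open>eta\<close>.\<close>
  define b where "b = (\<lambda>g\<in>carrier G. \<lambda>a\<in>S. inverse (z (mv (inv g) a) g))"
  have b_mem: "b g \<in> carrier M" if "g \<in> carrier G" for g
    using that by (simp add: b_def sector_module_simps(1) mv_closed z(1) norm_inverse)
  have b_apply: "b g a = inverse (z (mv (inv g) a) g)" if "g \<in> carrier G" "a \<in> S" for g a
    using that by (simp add: b_def)
  have "b \<in> carrier (cochains1 G M)"
    using b_mem by (auto simp: cochains1_def PiE_def b_def)
  moreover have "eta G R S mv W' = coboundary1 G M act b \<otimes>\<^bsub>cochains2 G M\<^esub> eta G R S mv W"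
  proof (rule extensionalityI[of _ "carrier G \<times> carrier G"])
    show "eta G R S mv W' \<in> extensional (carrier G \<times> carrier G)" by (simp add: eta_def)
    show "coboundary1 G M act b \<otimes>\<^bsub>cochains2 G M\<^esub> eta G R S mv W \<in> extensional (carrier G \<times> carrier G)"
      by (simp add: cochains2_def)
    fix p assume "p \<in> carrier G \<times> carrier G"
    then obtain g h where p: "p = (g, h)" and g: "g \<in> carrier G" and h: "h \<in> carrier G" by blast
    have gh: "g \<otimes> h \<in> carrier G" using g h by simp
    show "eta G R S mv W' p = (coboundary1 G M act b \<otimes>\<^bsub>cochains2 G M\<^esub> eta G R S mv W) p"
      unfolding p cochains2_mult[OF g h]
    proof (rule extensionalityI[of _ S])
      show "eta G R S mv W' (g, h) \<in> extensional S"
        using g h by (simp add: eta_def)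
      show "coboundary1 G M act b (g, h) \<otimes>\<^bsub>M\<^esub> eta G R S mv W (g, h) \<in> extensional S"
        by (simp add: sector_module_simps(2))
      fix a assume a: "a \<in> S"
      define a' where "a' = mv (inv (g \<otimes> h)) a"
      have a': "a' \<in> S" "mv h a' = mv (inv g) a" "mv (inv h) (mv (inv g) a) = a'"
        using a g h by (simp_all add: a'_def mv_mult inv_mult_group mv_closed)
          (simp add: m_assoc[symmetric])
      have "coboundary1 G M act b (g, h) a =
          inverse (z a' h) * z a' (g \<otimes> h) * inverse (z (mv (inv g) a) g)"
        using g h gh a a'(3) b_mem
        by (simp add: coboundary1_def sector_module_simps(2) inv_sector_module sector_action_apply
            b_apply mv_closed flip: a'_def)
      then show "eta G R S mv W' (g, h) a =
          (coboundary1 G M act b (g, h) \<otimes>\<^bsub>M\<^esub> eta G R S mv W (g, h)) a"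
        using w'[OF a'(1) g h] a a'(2) g h
        by (simp add: sector_module_simps(2) eta_apply flip: a'_def)
    qed
  qed
  ultimately show thesis by (rule that)
qed

lemma eta_class_independent:
  assumes W: "W_system W" and W': "W_system W'"
  shows "cohomology_class2 G M act (eta G R S mv W) = cohomology_class2 G M act (eta G R S mv W')"
proof -
  obtain b where "b \<in> carrier (cochains1 G M)"
    "eta G R S mv W' = coboundary1 G M act b \<otimes>\<^bsub>cochains2 G M\<^esub> eta G R S mv W"
    using W W' by (rule eta_cohomologous)
  then show ?thesis
    using G_module_sector_module eta_mem_cocycles2[OF W] by (intro cohomology_class2_eqI is_group)
qed

end

section \<open>The onsite action on the quasi-local algebra\<close>

lemma local_mult_closed:
  assumes "X \<in> local_matrices \<Lambda>" "Y \<in> local_matrices \<Lambda>"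
  shows "local_mult \<Lambda> X Y \<in> local_matrices \<Lambda>"
proof -
  have "s \<in> configs \<Lambda> \<and> t \<in> configs \<Lambda>" if nz: "local_mult \<Lambda> X Y s t \<noteq> 0" for s t
  proof -
    obtain r where "X s r * Y r t \<noteq> 0"
      using nz unfolding local_mult_def by (rule sum.not_neutral_contains_not_neutral)
    then show ?thesis using assms by (auto simp: local_matrices_def)
  qed
  then show ?thesis by (simp add: local_matrices_def)
qed

lemma local_star_closed: "X \<in> local_matrices \<Lambda> \<Longrightarrow> local_star X \<in> local_matrices \<Lambda>"
  by (auto simp: local_matrices_def local_star_def)

lemma tensor_matrix_closed: "tensor_matrix \<Lambda> A \<in> local_matrices \<Lambda>"
  by (auto simp: local_matrices_def tensor_matrix_def split: if_splits)

text \<open>Distributivity: a sum over configurations of products over sites is the product over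
  sites of sums over a single index.\<close>

lemma local_mult_tensor_matrix:
  fixes A B :: "site \<Rightarrow> complex^'d::finite^'d"
  assumes "finite \<Lambda>"
  shows "local_mult \<Lambda> (tensor_matrix \<Lambda> A) (tensor_matrix \<Lambda> B) = tensor_matrix \<Lambda> (\<lambda>z. A z ** B z)"
proof (intro ext)
  fix s t :: "'d config"
  have "(\<Sum>r\<in>configs \<Lambda>. (\<Prod>z\<in>\<Lambda>. A z $ s z $ r z) * (\<Prod>z\<in>\<Lambda>. B z $ r z $ t z)) =
      (\<Prod>z\<in>\<Lambda>. \<Sum>i\<in>UNIV. A z $ s z $ i * B z $ i $ t z)"
    using assms by (simp add: configs_def prod_sum_PiE prod.distrib)
  then show "local_mult \<Lambda> (tensor_matrix \<Lambda> A) (tensor_matrix \<Lambda> B) s t =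
      tensor_matrix \<Lambda> (\<lambda>z. A z ** B z) s t"
    by (auto simp: local_mult_def tensor_matrix_def matrix_matrix_mult_def intro!: sum.neutral)
qed

locale covariant_representation = group G for G :: "'g monoid" (structure) +
  fixes \<iota> :: "site set \<Rightarrow> 'd::finite local_matrix \<Rightarrow> 'a::cstar_algebra"
    and \<pi> :: "'a \<Rightarrow> 'h::chilbert_space \<Rightarrow> 'h"
    and U :: "'g \<Rightarrow> complex^'d^'d"
    and \<beta> :: "'g \<Rightarrow> 'a \<Rightarrow> 'a"
    and R :: "'g \<Rightarrow> 'h \<Rightarrow> 'h"
  assumes algebra: "quasi_local \<iota>"
    and U: "unitary_matrix_rep G U"
    and \<beta>: "onsite_action G U \<iota> \<beta>"
    and R: "unitary_operator_rep G R"
    and \<pi>: "representation \<pi>"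
    and covariant: "g \<in> carrier G \<Longrightarrow> Ad (R g) (\<pi> x) = \<pi> (\<beta> g x)"
begin

lemma \<iota>_mult:
  "finite I \<Longrightarrow> X \<in> local_matrices I \<Longrightarrow> Y \<in> local_matrices I \<Longrightarrow>
    \<iota> I (local_mult I X Y) = \<iota> I X * \<iota> I Y"
  using algebra by (simp add: quasi_local_def)

lemma \<iota>_star: "finite I \<Longrightarrow> X \<in> local_matrices I \<Longrightarrow> \<iota> I (local_star X) = star (\<iota> I X)"
  using algebra by (simp add: quasi_local_def)

lemma \<beta>_automorphism: "g \<in> carrier G \<Longrightarrow> star_automorphism (\<beta> g)"
  using \<beta> by (simp add: onsite_action_def)

lemma \<beta>_surj: "g \<in> carrier G \<Longrightarrow> surj (\<beta> g)"
  using \<beta>_automorphism by (simp add: star_automorphism_def bij_is_surj)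

abbreviation "conjugate I g X \<equiv>
  local_mult I (local_mult I (tensor_matrix I (\<lambda>_. U g)) X) (local_star (tensor_matrix I (\<lambda>_. U g)))"

lemma conjugate_closed: "X \<in> local_matrices I \<Longrightarrow> conjugate I g X \<in> local_matrices I"
  by (intro local_mult_closed local_star_closed tensor_matrix_closed)

lemma \<beta>_local:
  "g \<in> carrier G \<Longrightarrow> finite I \<Longrightarrow> X \<in> local_matrices I \<Longrightarrow> \<beta> g (\<iota> I X) = \<iota> I (conjugate I g X)"
  using \<beta> by (simp add: onsite_action_def)

lemma \<iota>_conjugate:
  assumes "finite I" "X \<in> local_matrices I"
  shows "\<iota> I (conjugate I g X) =
    \<iota> I (tensor_matrix I (\<lambda>_. U g)) * \<iota> I X * star (\<iota> I (tensor_matrix I (\<lambda>_. U g)))"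
  using assms by (simp add: \<iota>_mult \<iota>_star local_mult_closed local_star_closed tensor_matrix_closed)

text \<open>On a finite set the action is conjugation by the image of the tensor power of
  \<open>U g\<close>, and these images multiply as \<open>U\<close> does.\<close>

lemma \<beta>_mult_local:
  assumes g: "g \<in> carrier G" and h: "h \<in> carrier G" and I: "finite I" and X: "X \<in> local_matrices I"
  shows "\<beta> g (\<beta> h (\<iota> I X)) = \<beta> (g \<otimes> h) (\<iota> I X)"
proof -
  let ?u = "\<lambda>g. \<iota> I (tensor_matrix I (\<lambda>_. U g))"
  have "?u g * ?u h = \<iota> I (local_mult I (tensor_matrix I (\<lambda>_. U g)) (tensor_matrix I (\<lambda>_. U h)))"
    using I by (simp add: \<iota>_mult tensor_matrix_closed)
  also have "\<dots> = ?u (g \<otimes> h)"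
    using I U g h by (simp add: local_mult_tensor_matrix unitary_matrix_rep_def)
  finally have u: "?u (g \<otimes> h) = ?u g * ?u h" by simp
  have "\<beta> g (\<beta> h (\<iota> I X)) = ?u g * \<iota> I (conjugate I h X) * star (?u g)"
    by (simp only: \<beta>_local[OF h I X] \<beta>_local[OF g I conjugate_closed[OF X]]
        \<iota>_conjugate[OF I conjugate_closed[OF X]])
  also have "\<dots> = ?u (g \<otimes> h) * \<iota> I X * star (?u (g \<otimes> h))"
    using I X by (simp only: \<iota>_conjugate u star_mult mult.assoc)
  also have "\<dots> = \<beta> (g \<otimes> h) (\<iota> I X)"
    by (simp only: \<beta>_local[OF m_closed[OF g h] I X] \<iota>_conjugate[OF I X])
  finally show ?thesis .
qed

text \<open>Both composites with \<rho> are representations, and they agree on the dense union of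
  the local algebras.\<close>

lemma representation_\<beta>_mult:
  assumes \<rho>: "representation \<rho>" and g: "g \<in> carrier G" and h: "h \<in> carrier G"
  shows "\<rho> (\<beta> g (\<beta> h x)) = \<rho> (\<beta> (g \<otimes> h) x)"
proof (rule representations_eq_on_closure[of "\<lambda>x. \<rho> (\<beta> g (\<beta> h x))" "\<lambda>x. \<rho> (\<beta> (g \<otimes> h) x)"])
  show "representation (\<lambda>x. \<rho> (\<beta> g (\<beta> h x)))"
    using representation_comp_automorphism[OF \<rho> \<beta>_automorphism[OF g]] \<beta>_automorphism[OF h]
    by (rule representation_comp_automorphism)
  show "representation (\<lambda>x. \<rho> (\<beta> (g \<otimes> h) x))"
    using g h by (intro representation_comp_automorphism[OF \<rho>] \<beta>_automorphism) auto
  show "x \<in> closure (\<Union>\<Lambda>\<in>{\<Lambda>. finite \<Lambda>}. \<iota> \<Lambda> ` local_matrices \<Lambda>)"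
    using algebra by (simp add: quasi_local_def)
next
  fix y assume "y \<in> (\<Union>\<Lambda>\<in>{\<Lambda>. finite \<Lambda>}. \<iota> \<Lambda> ` local_matrices \<Lambda>)"
  then obtain \<Lambda> X where "finite \<Lambda>" "X \<in> local_matrices \<Lambda>" "y = \<iota> \<Lambda> X" by blast
  then show "\<rho> (\<beta> g (\<beta> h y)) = \<rho> (\<beta> (g \<otimes> h) y)" by (simp only: \<beta>_mult_local[OF g h])
qed

text \<open>Under \<rho>, applying \<open>\<beta> \<one>\<close> twice is the same as applying it
  once, and surjectivity lets one application be cancelled.\<close>

lemma representation_\<beta>_one:
  assumes \<rho>: "representation \<rho>"
  shows "\<rho> (\<beta> \<one> x) = \<rho> x"
proof -
  obtain y where "x = \<beta> \<one> y" using \<beta>_surj[OF one_closed] by (metis surjD)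
  then show ?thesis using representation_\<beta>_mult[OF \<rho>, of \<one> \<one> y] by simp
qed

text \<open>The action is onsite, so it keeps the matrices on each finite set in place and cannot
  leave the region; continuity extends the agreement to the closure.\<close>

lemma representations_eq_\<beta>_region:
  assumes \<rho>: "representation \<rho>" and \<sigma>: "representation \<sigma>"
    and eq: "\<And>x. x \<in> region_algebra \<iota> \<Gamma> \<Longrightarrow> \<rho> x = \<sigma> x"
    and g: "g \<in> carrier G" and x: "x \<in> region_algebra \<iota> \<Gamma>"
  shows "\<rho> (\<beta> g x) = \<sigma> (\<beta> g x)"
proof (rule representations_eq_on_closure[of "\<lambda>x. \<rho> (\<beta> g x)" "\<lambda>x. \<sigma> (\<beta> g x)"])
  let ?D = "\<Union>\<Lambda>\<in>{\<Lambda>. finite \<Lambda> \<and> \<Lambda> \<subseteq> lattice_points \<Gamma>}. \<iota> \<Lambda> ` local_matrices \<Lambda>"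
  show "representation (\<lambda>x. \<rho> (\<beta> g x))" "representation (\<lambda>x. \<sigma> (\<beta> g x))"
    by (rule representation_comp_automorphism[OF _ \<beta>_automorphism[OF g]], fact)+
  show "x \<in> closure ?D" using x by (simp add: region_algebra_def)
  fix y assume "y \<in> ?D"
  then obtain \<Lambda> X where "finite \<Lambda>" "\<Lambda> \<subseteq> lattice_points \<Gamma>" "X \<in> local_matrices \<Lambda>" "y = \<iota> \<Lambda> X"
    by auto
  then have "\<beta> g y \<in> ?D"
    using g by (auto simp: \<beta>_local intro!: exI[of _ \<Lambda>] imageI conjugate_closed)
  then have "\<beta> g y \<in> region_algebra \<iota> \<Gamma>"
    unfolding region_algebra_def by (rule subsetD[OF closure_subset])
  then show "\<rho> (\<beta> g y) = \<sigma> (\<beta> g y)" by (rule eq)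
qed

section \<open>The symmetry action on superselection sectors\<close>

abbreviation (input) "\<Theta> \<equiv> Theta G R \<beta>"

lemma unitary_R: "g \<in> carrier G \<Longrightarrow> unitary_operator (R g)"
  using R by (simp add: unitary_operator_rep_def)

text \<open>\<open>R \<one>\<close> equals its own square, and injectivity cancels one
  factor.\<close>

lemma R_one: "R \<one> v = v"
  using R unitary_R[of \<one>] by (metis comp_apply one_closed r_one unitary_cancel unitary_operator_rep_def)

lemma representation_Theta:
  assumes \<rho>: "representation \<rho>" and g: "g \<in> carrier G"
  shows "representation (\<Theta> g \<rho>)"
  unfolding Theta_def
  using unitary_R[OF g] representation_comp_automorphism[OF \<rho> \<beta>_automorphism[OF inv_closed[OF g]]]
  by (rule representation_Ad)

lemma Theta_mult:
  assumes \<rho>: "representation \<rho>" and g: "g \<in> carrier G" and h: "h \<in> carrier G"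
  shows "\<Theta> g (\<Theta> h \<rho>) = \<Theta> (g \<otimes> h) \<rho>"
proof -
  have "R (g \<otimes> h) = R g \<circ> R h" using R g h by (simp add: unitary_operator_rep_def)
  then show ?thesis
    using g h by (simp add: Theta_def representation_\<beta>_mult[OF \<rho>] inv_mult_group Ad_comp unitary_R)
qed

lemma Theta_one:
  assumes \<rho>: "representation \<rho>"
  shows "\<Theta> \<one> \<rho> = \<rho>"
proof -
  have "R \<one> = (\<lambda>v. v)" using R_one by blast
  then show ?thesis
    by (simp add: Theta_def representation_\<beta>_one[OF \<rho>] Ad_def comp_def hadj_id)
qed

lemma Theta_\<pi>:
  assumes g: "g \<in> carrier G"
  shows "\<Theta> g \<pi> = \<pi>"
  using g by (simp add: Theta_def covariant representation_\<beta>_mult[OF \<pi>] representation_\<beta>_one[OF \<pi>])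

text \<open>Conjugation by \<open>R g\<close> transports unitaries along \<open>Theta g\<close>.
  This handles both the superselection criterion and unitary equivalence.\<close>

lemma Theta_Ad:
  assumes g: "g \<in> carrier G" and V: "unitary_operator V"
  shows "Ad (R g \<circ> V \<circ> hadj (R g)) (\<Theta> g \<rho> x) = \<Theta> g (\<lambda>x. Ad V (\<rho> x)) x"
  using V unitary_R[OF g] by (simp add: Theta_def Ad_comp unitary_comp unitary_hadj)

lemma Theta_eq_\<pi>:
  assumes \<rho>: "representation \<rho>" and g: "g \<in> carrier G"
    and eq: "\<And>x. x \<in> region_algebra \<iota> \<Gamma> \<Longrightarrow> \<rho> x = \<pi> x" and x: "x \<in> region_algebra \<iota> \<Gamma>"
  shows "\<Theta> g \<rho> x = \<pi> x"
proof -
  have "\<Theta> g \<rho> x = \<Theta> g \<pi> x"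
    using representations_eq_\<beta>_region[OF \<rho> \<pi> eq inv_closed[OF g] x] by (simp add: Theta_def)
  then show ?thesis by (simp add: Theta_\<pi> g)
qed

text \<open>The same cone works before and after, because the onsite action preserves the algebra of
  its complement; the unitary is conjugated by \<open>R g\<close>.\<close>

lemma superselection_Theta:
  assumes \<rho>: "representation \<rho>" and sup: "superselection \<iota> \<pi> \<rho>" and g: "g \<in> carrier G"
  shows "superselection \<iota> \<pi> (\<Theta> g \<rho>)"
  unfolding superselection_def
proof
  fix \<Lambda> assume "\<Lambda> \<in> cones"
  then obtain V where V: "unitary_operator V"
    and eq: "\<And>x. x \<in> region_algebra \<iota> (- \<Lambda>) \<Longrightarrow> Ad V (\<rho> x) = \<pi> x"
    using sup unfolding superselection_def by blast
  have "Ad (R g \<circ> V \<circ> hadj (R g)) (\<Theta> g \<rho> x) = \<pi> x" if "x \<in> region_algebra \<iota> (- \<Lambda>)" for x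
    unfolding Theta_Ad[OF g V] using representation_Ad[OF V \<rho>] g eq that by (rule Theta_eq_\<pi>)
  moreover have "unitary_operator (R g \<circ> V \<circ> hadj (R g))"
    using V unitary_R[OF g] by (intro unitary_comp unitary_hadj)
  ultimately show "\<exists>V. unitary_operator V \<and> (\<forall>x\<in>region_algebra \<iota> (- \<Lambda>). Ad V (\<Theta> g \<rho> x) = \<pi> x)"
    by blast
qed

lemma O_set_Theta: "\<rho> \<in> O_set \<iota> \<pi> \<Lambda> \<Longrightarrow> g \<in> carrier G \<Longrightarrow> \<Theta> g \<rho> \<in> O_set \<iota> \<pi> \<Lambda>"
  by (simp add: O_set_def representation_Theta superselection_Theta Theta_eq_\<pi>[of _ _ "- \<Lambda>"])

lemma irreducible_Theta:
  assumes irr: "irreducible_rep \<rho>" and g: "g \<in> carrier G"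
  shows "irreducible_rep (\<Theta> g \<rho>)"
  unfolding irreducible_rep_def
proof (intro allI impI)
  fix X :: "'h set" assume sub: "csubspace X" and cl: "closed X" and inv: "\<forall>x. \<Theta> g \<rho> x ` X \<subseteq> X"
  note Rg = unitary_R[OF g] and op = unitary_operatorD(1)[OF unitary_R[OF g]]
  have R0: "R g 0 = 0" using bounded_operator_imp_linear[OF op] by (rule linear_0)
  let ?Y = "R g -` X"
  have "csubspace ?Y"
    using sub by (simp add: csubspace_def R0 bounded_operator_add[OF op] bounded_operator_scaleC[OF op])
  moreover have "closed ?Y"
    using cl linear_continuous_on[OF bounded_operator_imp_bounded_linear[OF op]]
    by (intro closed_vimage)
  moreover have "\<rho> y ` ?Y \<subseteq> ?Y" for y
  proof -
    \<comment> \<open>Surjectivity of the automorphism lets invariance under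
      \<open>Theta g \<rho>\<close> control every \<open>\<rho> y\<close>.\<close>
    obtain x where y: "y = \<beta> (inv g) x" using \<beta>_surj[of "inv g"] g by (metis inv_closed surjD)
    have "R g (\<rho> y v) = \<Theta> g \<rho> x (R g v)" for v
      using Rg by (simp add: Theta_def Ad_def y)
    then show ?thesis using inv by (auto simp: image_subset_iff)
  qed
  ultimately have "?Y = {0} \<or> ?Y = UNIV"
    using irr unfolding irreducible_rep_def by blast
  moreover have "R g ` ?Y = X"
    using unitary_operatorD(2)[OF Rg] by (rule surj_image_vimage_eq)
  ultimately show "X = {0} \<or> X = UNIV"
    using R0 unitary_operatorD(2)[OF Rg] by (metis image_empty image_insert)
qed

lemma unitarily_equivalent_Theta:
  assumes "unitarily_equivalent \<rho> \<sigma>" and g: "g \<in> carrier G"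
  shows "unitarily_equivalent (\<Theta> g \<rho>) (\<Theta> g \<sigma>)"
proof -
  obtain V where V: "unitary_operator V" and "\<And>x. Ad V (\<rho> x) = \<sigma> x"
    using assms(1) unfolding unitarily_equivalent_def by blast
  then have "Ad (R g \<circ> V \<circ> hadj (R g)) (\<Theta> g \<rho> x) = \<Theta> g \<sigma> x" for x
    by (simp add: Theta_Ad[OF g])
  moreover have "unitary_operator (R g \<circ> V \<circ> hadj (R g))"
    using V unitary_R[OF g] by (intro unitary_comp unitary_hadj)
  ultimately show ?thesis unfolding unitarily_equivalent_def by blast
qed

end

section \<open>Sectors as equivalence classes and the action on them\<close>

lemma equiv_Irr_equiv:
  "equiv {\<rho> \<in> O_set \<iota> \<pi> \<Lambda>. irreducible_rep \<rho>} (Irr_equiv \<iota> \<pi> \<Lambda>)"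
proof (rule equivI)
  show "Irr_equiv \<iota> \<pi> \<Lambda> \<subseteq> {\<rho> \<in> O_set \<iota> \<pi> \<Lambda>. irreducible_rep \<rho>} \<times> {\<rho> \<in> O_set \<iota> \<pi> \<Lambda>. irreducible_rep \<rho>}"
    by (auto simp: Irr_equiv_def)
  have "Ad (\<lambda>v. v) T = T" for T :: "'h::chilbert_space \<Rightarrow> 'h"
    by (simp add: Ad_def hadj_id comp_def)
  then have "unitarily_equivalent \<rho> \<rho>" for \<rho> :: "'a::cstar_algebra \<Rightarrow> 'h::chilbert_space \<Rightarrow> 'h"
    unfolding unitarily_equivalent_def using unitary_id by blast
  then show "refl_on {\<rho> \<in> O_set \<iota> \<pi> \<Lambda>. irreducible_rep \<rho>} (Irr_equiv \<iota> \<pi> \<Lambda>)"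
    by (auto simp: refl_on_def Irr_equiv_def)
  have "unitarily_equivalent \<sigma> \<rho>" if "unitarily_equivalent \<rho> \<sigma>"
    for \<rho> \<sigma> :: "'a::cstar_algebra \<Rightarrow> 'h::chilbert_space \<Rightarrow> 'h"
    using that unfolding unitarily_equivalent_def by (metis Ad_hadj_Ad unitary_hadj)
  then show "sym (Irr_equiv \<iota> \<pi> \<Lambda>)"
    by (auto simp: sym_def Irr_equiv_def)
  have "unitarily_equivalent \<rho> \<tau>" if "unitarily_equivalent \<rho> \<sigma>" "unitarily_equivalent \<sigma> \<tau>"
    for \<rho> \<sigma> \<tau> :: "'a::cstar_algebra \<Rightarrow> 'h::chilbert_space \<Rightarrow> 'h"
    using that unfolding unitarily_equivalent_def by (metis Ad_comp unitary_comp)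
  then show "trans (Irr_equiv \<iota> \<pi> \<Lambda>)"
    unfolding trans_def Irr_equiv_def by blast
qed

text \<open>A zero cyclic vector would force \<open>\<omega> 1 = 0\<close>, against the
  normalisation of a state.\<close>

lemma GNS_nontrivial:
  assumes "pure_state \<omega>" "GNS_triple \<omega> \<pi> \<Omega>"
  shows "\<Omega> \<noteq> 0"
proof
  assume "\<Omega> = 0"
  then have "\<omega> 1 = 0" using assms(2) by (simp add: GNS_triple_def)
  moreover have "\<omega> 1 = 1" using assms(1) by (simp add: pure_state_def state_def)
  ultimately show False by simp
qed

locale sector_choice = covariant_representation G \<iota> \<pi> U \<beta> R
  for G :: "'g monoid" (structure)
    and \<iota> :: "site set \<Rightarrow> 'd::finite local_matrix \<Rightarrow> 'a::cstar_algebra"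
    and \<pi> :: "'a \<Rightarrow> 'h::chilbert_space \<Rightarrow> 'h" and U \<beta> R +
  fixes \<Lambda>\<^sub>0 :: "(real \<times> real) set" and rep :: "('a \<Rightarrow> 'h \<Rightarrow> 'h) set \<Rightarrow> 'a \<Rightarrow> 'h \<Rightarrow> 'h"
  assumes rep: "a \<in> sectors \<iota> \<pi> \<Lambda>\<^sub>0 \<Longrightarrow> rep a \<in> a"
    and nontrivial: "\<exists>v::'h. v \<noteq> 0"
begin

abbreviation "S \<equiv> sectors \<iota> \<pi> \<Lambda>\<^sub>0"
abbreviation "Irr \<equiv> {\<rho> \<in> O_set \<iota> \<pi> \<Lambda>\<^sub>0. irreducible_rep \<rho>}"
abbreviation "E \<equiv> Irr_equiv \<iota> \<pi> \<Lambda>\<^sub>0"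
abbreviation "mv \<equiv> \<lambda>g a. E `` {\<Theta> g (rep a)}"

lemma rep_mem_Irr:
  assumes a: "a \<in> S"
  shows "rep a \<in> Irr"
proof -
  have "a \<subseteq> Irr" using equiv_Irr_equiv a unfolding sectors_def by (rule in_quotient_imp_subset)
  then show ?thesis using rep[OF a] by (rule subsetD)
qed

lemma class_rep:
  assumes a: "a \<in> S"
  shows "E `` {rep a} = a"
proof -
  obtain \<rho> where \<rho>: "a = E `` {\<rho>}" using a unfolding sectors_def by (rule quotientE)
  then have "(\<rho>, rep a) \<in> E" using rep[OF a] by simp
  then show ?thesis unfolding \<rho> by (rule equiv_class_eq[OF equiv_Irr_equiv, symmetric])
qed

lemma Theta_Irr: "\<rho> \<in> Irr \<Longrightarrow> g \<in> carrier G \<Longrightarrow> \<Theta> g \<rho> \<in> Irr"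
  by (simp add: O_set_Theta irreducible_Theta)

lemma Irr_representation: "\<rho> \<in> Irr \<Longrightarrow> representation \<rho>"
  by (simp add: O_set_def)

text \<open>\<open>mv g (mv h a)\<close> applies \<open>Theta g\<close> to a newly chosen
  representative, known only to be equivalent to \<open>Theta h (rep a)\<close>. Compatibility with
  equivalence makes that choice immaterial and gives the action law.\<close>

lemma class_Theta_cong:
  assumes "(\<rho>, \<sigma>) \<in> E" "g \<in> carrier G"
  shows "E `` {\<Theta> g \<rho>} = E `` {\<Theta> g \<sigma>}"
proof (rule equiv_class_eq[OF equiv_Irr_equiv])
  show "(\<Theta> g \<rho>, \<Theta> g \<sigma>) \<in> E"
    using assms by (simp add: Irr_equiv_def O_set_Theta irreducible_Theta unitarily_equivalent_Theta)
qed

sublocale sector_system G S mv R \<beta> rep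
proof
  show closed: "mv g a \<in> S" if "g \<in> carrier G" "a \<in> S" for g a
    unfolding sectors_def using that by (intro quotientI Theta_Irr rep_mem_Irr)
  show "mv g (mv h a) = mv (g \<otimes> h) a" if g: "g \<in> carrier G" and h: "h \<in> carrier G" and a: "a \<in> S" for g h a
  proof -
    have "(\<Theta> h (rep a), rep (mv h a)) \<in> E" using rep[OF closed[OF h a]] by simp
    from class_Theta_cong[OF this g] show ?thesis
      by (simp add: Theta_mult[OF Irr_representation[OF rep_mem_Irr[OF a]] g h])
  qed
  show "mv \<one> a = a" if "a \<in> S" for a
    using class_rep[OF that] by (simp add: Theta_one[OF Irr_representation[OF rep_mem_Irr[OF that]]])
  show "unitary_operator_rep G R" by (rule R)
  show "rep a (\<beta> (inv h) (\<beta> (inv g) x)) = rep a (\<beta> (inv (g \<otimes> h)) x)"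
    if "a \<in> S" "g \<in> carrier G" "h \<in> carrier G" for a g h x
    using that(2,3) representation_\<beta>_mult[OF Irr_representation[OF rep_mem_Irr[OF that(1)]]]
    by (simp add: inv_mult_group)
  show "\<exists>c. \<forall>v. T v = c *\<^sub>C v"
    if "a \<in> S" "unitary_operator T" "\<And>x. Ad T (rep a x) = rep a x" for a T
  proof -
    have "irreducible_rep (rep a)" using rep_mem_Irr[OF that(1)] by simp
    from schur_unitary[OF this Irr_representation[OF rep_mem_Irr[OF that(1)]] that(2,3)]
    show ?thesis by metis
  qed
  show "\<exists>v::'h. v \<noteq> 0" by (rule nontrivial)
qed

end

text \<open>The identity between \<open>omega_operator\<close> and \<open>omega_scalar\<close> is
  part of the conclusion: it certifies that the definite description denotes the intended
  scalar.\<close>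

theorem lemma1p9:
  fixes \<iota> :: "site set \<Rightarrow> 'd::finite local_matrix \<Rightarrow> 'a::cstar_algebra"
    and \<omega> :: "'a \<Rightarrow> complex"
    and \<pi> :: "'a \<Rightarrow> 'h::chilbert_space \<Rightarrow> 'h"
    and \<Omega> :: 'h
    and G :: "'g monoid"
    and U :: "'g \<Rightarrow> complex^'d^'d"
    and \<beta> :: "'g \<Rightarrow> 'a \<Rightarrow> 'a"
    and R :: "'g \<Rightarrow> 'h \<Rightarrow> 'h"
    and \<phi>\<^sub>0 :: real
    and \<Lambda>\<^sub>0 :: "(real \<times> real) set"
    and S :: "('a \<Rightarrow> 'h \<Rightarrow> 'h) set set"
    and rep :: "('a \<Rightarrow> 'h \<Rightarrow> 'h) set \<Rightarrow> 'a \<Rightarrow> 'h \<Rightarrow> 'h"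
    and mv :: "'g \<Rightarrow> ('a \<Rightarrow> 'h \<Rightarrow> 'h) set \<Rightarrow> ('a \<Rightarrow> 'h \<Rightarrow> 'h) set"
    and M :: "(('a \<Rightarrow> 'h \<Rightarrow> 'h) set \<Rightarrow> complex) monoid"
    and act :: "'g \<Rightarrow> (('a \<Rightarrow> 'h \<Rightarrow> 'h) set \<Rightarrow> complex) \<Rightarrow> ('a \<Rightarrow> 'h \<Rightarrow> 'h) set \<Rightarrow> complex"
  assumes d: "2 \<le> CARD('d)"
    and algebra: "quasi_local \<iota>"
    and pure: "pure_state \<omega>"
    and GNS: "GNS_triple \<omega> \<pi> \<Omega>"
    and G: "group G" "finite (carrier G)"
    and U: "unitary_matrix_rep G U" "inj_on (\<lambda>g. mAd (U g)) (carrier G)"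
    and \<beta>: "onsite_action G U \<iota> \<beta>"
    and invariant: "\<And>g. g \<in> carrier G \<Longrightarrow> \<omega> \<circ> \<beta> g = \<omega>"
    and R: "unitary_operator_rep G R"
    and covariant: "\<And>g x. g \<in> carrier G \<Longrightarrow> Ad (R g) (\<pi> x) = \<pi> (\<beta> g x)"
    and \<phi>\<^sub>0: "0 < \<phi>\<^sub>0" "\<phi>\<^sub>0 < pi / 2"
    and \<Lambda>\<^sub>0: "\<Lambda>\<^sub>0 \<in> cones_avoiding (3 * pi / 2) (pi / 2) \<inter> cones_avoiding 0 \<phi>\<^sub>0"
    and S_def: "S = sectors \<iota> \<pi> \<Lambda>\<^sub>0"
    and rep: "\<And>a. a \<in> S \<Longrightarrow> rep a \<in> a"
    and mv_def: "mv = (\<lambda>g a. Irr_equiv \<iota> \<pi> \<Lambda>\<^sub>0 `` {Theta G R \<beta> g (rep a)})"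
    and M_def: "M = sector_module S"
    and act_def: "act = sector_action G S mv"
  shows "G_module G M act \<and>
    (\<forall>W. intertwiners G R \<beta> S rep mv W \<longrightarrow>
       (\<forall>a\<in>S. \<forall>g\<in>carrier G. \<forall>h\<in>carrier G.
          omega_operator G R mv W a g h = (\<lambda>v. omega_scalar G R mv W a g h *\<^sub>C v)) \<and>
       eta G R S mv W \<in> cocycles2 G M act \<and>
       cohomology_class2 G M act (eta G R S mv W) \<in> carrier (cohomology2 G M act) \<and>
       (\<forall>g\<in>carrier G. \<forall>h\<in>carrier G. \<forall>k\<in>carrier G. \<forall>a\<in>S.
          eta G R S mv W (h, k) (mv (inv\<^bsub>G\<^esub> g) a) * eta G R S mv W (g, h \<otimes>\<^bsub>G\<^esub> k) a =
          eta G R S mv W (g \<otimes>\<^bsub>G\<^esub> h, k) a * eta G R S mv W (g, h) a)) \<and>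
    (\<forall>W W'. intertwiners G R \<beta> S rep mv W \<longrightarrow> intertwiners G R \<beta> S rep mv W' \<longrightarrow>
       cohomology_class2 G M act (eta G R S mv W) = cohomology_class2 G M act (eta G R S mv W'))"
proof -
  interpret group G by fact
  interpret sector_choice G \<iota> \<pi> U \<beta> R \<Lambda>\<^sub>0 rep
  proof
    show "quasi_local \<iota>" "unitary_matrix_rep G U" "onsite_action G U \<iota> \<beta>" "unitary_operator_rep G R"
      by fact+
    show "representation \<pi>" using GNS by (simp add: GNS_triple_def)
    show "Ad (R g) (\<pi> x) = \<pi> (\<beta> g x)" if "g \<in> carrier G" for g x
      using that by (rule covariant)
    show "rep a \<in> a" if "a \<in> sectors \<iota> \<pi> \<Lambda>\<^sub>0" for a
      using that unfolding S_def[symmetric] by (rule rep)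
    show "\<exists>v::'h. v \<noteq> 0" using GNS_nontrivial[OF pure GNS] by (rule exI)
  qed
  show ?thesis
    unfolding act_def M_def mv_def S_def
    by (intro conjI allI impI ballI;
        (rule G_module_sector_module omega_scalar(3) eta_mem_cocycles2 eta_cocycle_identity
          eta_mem_cocycles2[THEN cohomology_class2_mem] eta_class_independent; assumption))
qed

end
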